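(* Assume that the given functions $f,c^0$ on $[0,L]$ and $I,\varepsilon_A,\varepsilon_B$ on $[\lambda_0,\lambda_*]$ are continuously differentiable, with $f\ge 0$, $0\le I\le 1$, $c^0>0$, and let $\phi:(0,\infty)\to(0,\infty)$ satisfy $\phi(\Delta t)=\Delta t+\mathcal{O}(\Delta t^2)$ as $\Delta t\to 0$. Let $c$ be the solution of the integro-differential photochemical model and let $\{c_j^n\}$ be its approximations computed by the NSFD scheme (both described in the context) with $\Delta x=L/N_x$, $\Delta t=T/N_t$, $\Delta\lambda=(\lambda_*-\lambda_0)/N_\lambda$, $N_x,N_t,N_\lambda$ positive integers. Then $$\max_{0\le n\le N_t,\;0\le j\le N_x}|c(x_j,t_n)-c_j^n|\longrightarrow 0\qquad\text{as }\Delta x+\Delta t+\Delta\lambda\to 0.$$ Furthermore, the NSFD method is convergent of order $1$, that is, there is a constant $\tilde\kappa>0$ independent of the stepsizes such that, for all sufficiently small stepsizes, $$\max_{0\le n\le N_t,\;0\le j\le N_x}|c(x_j,t_n)-c_j^n|\le\tilde\kappa(\Delta t+\Delta x+\Delta\lambda).$$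
   Context: Constants: $L,T>0$, $\lambda_0<\lambda_*$, $\mu>0$, $a_1>0$, $a_2\ge 0$. Put $\rho(X)=\dfrac{a_1X}{X^2+a_2X+1}$ for $X\ge 0$, $C_0(x)=\int_0^x c^0(\xi)\,d\xi$, and $$\iota(\lambda,y,s)=I(\lambda)\exp\{-\mu(\varepsilon_B(\lambda)\,y+(\varepsilon_A(\lambda)-\varepsilon_B(\lambda))\,s)\}.$$ Model: $c(x,t)$ is the (classical) solution on $[0,L]\times[0,T]$ of $$\frac{\partial c}{\partial t}(x,t)=-c(x,t)f(x)\int_{\lambda_0}^{\lambda_*}\rho\Big(\iota\Big(\lambda,C_0(x),\int_0^x c(\xi,t)\,d\xi\Big)\Big)d\lambda,\qquad c(x,0)=c^0(x).$$ Grid: $x_j=j\Delta x$, $t_n=n\Delta t$, $\lambda_l=\lambda_0+l\Delta\lambda$. NSFD scheme: $c_j^0=c^0(x_j)$ and, for $n,j\ge 0$, $$\frac{c_j^{n+1}-c_j^n}{\phi(\Delta t)}=-c_j^{n+1}f(x_j)\,\Delta\lambda\sum_{l=0}^{N_\lambda-1}\rho\Big(\iota\Big(\lambda_l,C_0(x_j),\Delta x\sum_{r=0}^{j-1}c_r^n\Big)\Big),$$ where an empty sum is $0$. *)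

theory Defs
  imports "HOL-Analysis.Analysis" "HOL-Library.Landau_Symbols"
begin

text \<open>
  Continuous differentiability of a function given on the closed interval \<open>{a..b}\<close>, with one-sided
  derivatives at the endpoints. The library's \<^const>\<open>C1_differentiable_on\<close> asks for two-sided
  derivatives and so would constrain the values outside the interval.
\<close>

definition C1_on_interval :: "real \<Rightarrow> real \<Rightarrow> (real \<Rightarrow> real) \<Rightarrow> bool" where
  "C1_on_interval a b g \<longleftrightarrow>
     (\<exists>g'. (\<forall>x\<in>{a..b}. (g has_real_derivative g' x) (at x within {a..b})) \<and> continuous_on {a..b} g')"

definition rho :: "real \<Rightarrow> real \<Rightarrow> real \<Rightarrow> real" where
  "rho a1 a2 X = a1 * X / (X\<^sup>2 + a2 * X + 1)"

definition iota ::
  "real \<Rightarrow> (real \<Rightarrow> real) \<Rightarrow> (real \<Rightarrow> real) \<Rightarrow> (real \<Rightarrow> real) \<Rightarrow> real \<Rightarrow> real \<Rightarrow> real \<Rightarrow> real" where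
  "iota \<mu> I \<epsilon>A \<epsilon>B l y s = I l * exp (- \<mu> * (\<epsilon>B l * y + (\<epsilon>A l - \<epsilon>B l) * s))"

definition cumulative :: "(real \<Rightarrow> real) \<Rightarrow> real \<Rightarrow> real" where
  "cumulative g x = integral {0..x} g"

text \<open>
  Classical solutions on the closed rectangle: jointly continuous, with the time derivative existing
  everywhere (one-sided at \<open>t = 0\<close> and \<open>t = T\<close>). Continuity of the time derivative then follows from
  the equation; no differentiability in \<open>x\<close> is required.
\<close>

definition classical_solution ::
  "real \<Rightarrow> real \<Rightarrow> real \<Rightarrow> real \<Rightarrow> real \<Rightarrow> real \<Rightarrow> real \<Rightarrow>
   (real \<Rightarrow> real) \<Rightarrow> (real \<Rightarrow> real) \<Rightarrow> (real \<Rightarrow> real) \<Rightarrow> (real \<Rightarrow> real) \<Rightarrow> (real \<Rightarrow> real) \<Rightarrow>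
   (real \<Rightarrow> real \<Rightarrow> real) \<Rightarrow> bool" where
  "classical_solution L T l0 l1 \<mu> a1 a2 f c0 I \<epsilon>A \<epsilon>B c \<longleftrightarrow>
     continuous_on ({0..L} \<times> {0..T}) (\<lambda>(x, t). c x t) \<and>
     (\<forall>x\<in>{0..L}. c x 0 = c0 x) \<and>
     (\<forall>x\<in>{0..L}. \<forall>t\<in>{0..T}.
        ((\<lambda>s. c x s) has_real_derivative
           - c x t * f x *
             integral {l0..l1}
               (\<lambda>l. rho a1 a2 (iota \<mu> I \<epsilon>A \<epsilon>B l (cumulative c0 x) (integral {0..x} (\<lambda>\<xi>. c \<xi> t)))))
        (at t within {0..T}))"

text \<open>
  The scheme as a predicate on the grid function \<open>u n j\<close>, the approximation at time level \<open>n\<close> and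
  space index \<open>j\<close>. It is imposed exactly on the grid points of \<open>{0..L} \<times> {0..T}\<close>. The step sizes are
  \<open>L / Nx\<close>, \<open>T / Nt\<close> and \<open>(l1 - l0) / Nl\<close>.
\<close>

definition nsfd_scheme ::
  "real \<Rightarrow> real \<Rightarrow> real \<Rightarrow> real \<Rightarrow> real \<Rightarrow> real \<Rightarrow> real \<Rightarrow>
   (real \<Rightarrow> real) \<Rightarrow> (real \<Rightarrow> real) \<Rightarrow> (real \<Rightarrow> real) \<Rightarrow> (real \<Rightarrow> real) \<Rightarrow> (real \<Rightarrow> real) \<Rightarrow>
   (real \<Rightarrow> real) \<Rightarrow> nat \<Rightarrow> nat \<Rightarrow> nat \<Rightarrow> (nat \<Rightarrow> nat \<Rightarrow> real) \<Rightarrow> bool" where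
  "nsfd_scheme L T l0 l1 \<mu> a1 a2 f c0 I \<epsilon>A \<epsilon>B \<phi> Nx Nt Nl u \<longleftrightarrow>
     (let \<Delta>x = L / real Nx; \<Delta>t = T / real Nt; \<Delta>l = (l1 - l0) / real Nl in
       (\<forall>j\<le>Nx. u 0 j = c0 (real j * \<Delta>x)) \<and>
       (\<forall>n<Nt. \<forall>j\<le>Nx.
          (u (Suc n) j - u n j) / \<phi> \<Delta>t =
            - u (Suc n) j * f (real j * \<Delta>x) * \<Delta>l *
              (\<Sum>m<Nl. rho a1 a2 (iota \<mu> I \<epsilon>A \<epsilon>B (l0 + real m * \<Delta>l)
                          (cumulative c0 (real j * \<Delta>x)) (\<Delta>x * (\<Sum>r<j. u n r))))))"

definition max_error ::
  "real \<Rightarrow> real \<Rightarrow> nat \<Rightarrow> nat \<Rightarrow> (real \<Rightarrow> real \<Rightarrow> real) \<Rightarrow> (nat \<Rightarrow> nat \<Rightarrow> real) \<Rightarrow> real" where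
  "max_error L T Nx Nt c u =
     Max ((\<lambda>(n, j). \<bar>c (real j * (L / real Nx)) (real n * (T / real Nt)) - u n j\<bar>) ` ({..Nt} \<times> {..Nx}))"

end

theory Submission
  imports Defs
begin

text \<open>
  The proof is the classical one, consistency and stability give convergence, carried out for an
  equation that is nonlocal in space and in the wavelength.

  Stability comes from the form of the scheme. The numerical solution decays through
  \<open>(1 + \<phi>(\<Delta>t) * f * Q) * u\<^sup>n\<^sup>+\<^sup>1 = u\<^sup>n\<close> with a discrete rate \<open>Q \<ge> 0\<close>, because \<open>\<rho>\<close> is nonnegative on
  nonnegative arguments. As also \<open>f \<ge> 0\<close>, the factor on the left is at least \<open>1\<close> for all step sizes. The numerical
  solution therefore obeys the bound \<open>M\<close> of the exact one (\<open>scheme_bounded\<close>), and a step never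
  amplifies the existing error by itself (\<open>implicit_step_error\<close>).

  Consistency rests on Lipschitz estimates. The integrand \<open>\<rho>(\<iota>(\<lambda>, y, s))\<close> is Lipschitz in its
  three arguments on bounded sets (\<open>rho_iota_lipschitz\<close>), so the wavelength sum is a left Riemann sum
  of first order. The exact solution is Lipschitz in time with a time derivative that is again Lipschitz
  in time, which gives a truncation error of size \<open>\<Delta>t\<^sup>2\<close> per step (\<open>truncation_error\<close>). For
  the space sum the exact solution has to be Lipschitz in \<open>x\<close>, which is not part of its definition:
  it follows from an energy estimate for the difference of the solution at two places
  (\<open>dissipative_linear_ode_bound\<close>, \<open>solution_regularity\<close>).

  Replacing \<open>\<Delta>t\<close> by \<open>\<phi>(\<Delta>t)\<close> changes a step by \<open>O(\<Delta>t\<^sup>2)\<close> only. Since the discrete rate depends on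
  the numerical values through a Riemann sum, it is off by at most a constant times
  \<open>\<Delta>\<lambda> + \<Delta>x + E\<close>, where \<open>E\<close> bounds the errors on the current time level. Together, with
  \<open>h = \<Delta>t + \<Delta>x + \<Delta>\<lambda>\<close>, one step takes \<open>E\<close> to at most
  \<open>(1 + \<kappa> * \<Delta>t) * E + \<kappa> * \<Delta>t * h\<close> (\<open>error_step\<close>), and the discrete Gronwall argument yields
  \<open>E \<le> exp (\<kappa> * T) * h\<close> on the whole grid (\<open>error_bound\<close>). Convergence is a consequence of this
  first-order bound.
\<close>

section \<open>Lipschitz functions and left Riemann sums\<close>

lemma C1_on_interval_lipschitz_bounded:
  assumes "C1_on_interval a b g"
  obtains K B where "K-lipschitz_on {a..b} g" and "B \<ge> 0" and "\<And>x. x \<in> {a..b} \<Longrightarrow> \<bar>g x\<bar> \<le> B"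
proof -
  obtain g' where d: "\<And>x. x\<in>{a..b} \<Longrightarrow> (g has_real_derivative g' x) (at x within {a..b})"
    and g': "continuous_on {a..b} g'"
    using assms unfolding C1_on_interval_def by blast
  have "bounded (g' ` {a..b})"
    using g' compact_continuous_image compact_imp_bounded by blast
  then obtain K where K: "K > 0" "\<And>x. x \<in> {a..b} \<Longrightarrow> \<bar>g' x\<bar> \<le> K"
    by (auto simp: bounded_pos)
  have lip: "K-lipschitz_on {a..b} g"
  proof (rule lipschitz_onI)
    fix x y assume xy: "x \<in> {a..b}" "y \<in> {a..b}"
    show "dist (g x) (g y) \<le> K * dist x y"
      unfolding dist_norm
      by (rule field_differentiable_bound[OF _ d]) (use K xy in auto)
  qed (use K in auto)
  have "bounded (g ` {a..b})"
    using lipschitz_on_continuous_on[OF lip] compact_continuous_image compact_imp_bounded by blast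
  then obtain B where B: "B > 0" "\<And>x. x \<in> {a..b} \<Longrightarrow> \<bar>g x\<bar> \<le> B"
    by (auto simp: bounded_pos)
  show thesis using that[OF lip _ B(2)] B(1) by simp
qed

lemma integral_diff_bound:
  fixes g h :: "real \<Rightarrow> real"
  assumes "a \<le> b" and "continuous_on {a..b} g" and "continuous_on {a..b} h"
    and "\<And>x. x \<in> {a..b} \<Longrightarrow> \<bar>g x - h x\<bar> \<le> C"
  shows "\<bar>integral {a..b} g - integral {a..b} h\<bar> \<le> C * (b - a)"
proof -
  have "integral {a..b} g - integral {a..b} h = integral {a..b} (\<lambda>x. g x - h x)"
    using assms by (intro integral_diff[symmetric] integrable_continuous_real)
  moreover have "norm (integral {a..b} (\<lambda>x. g x - h x)) \<le> C * (b - a)"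
    using assms by (intro integral_bound continuous_intros) auto
  ultimately show ?thesis by simp
qed

text \<open>
  One panel of width \<open>h\<close> costs at most \<open>K * h\<^sup>2\<close>, and there are \<open>N\<close> of them. The same estimate serves
  the wavelength integral and the space integral of the model, whose endpoint is an arbitrary grid point.
\<close>

lemma left_riemann_sum_error:
  fixes g :: "real \<Rightarrow> real"
  assumes "h \<ge> 0" and "K-lipschitz_on {a..a + real N * h} g"
  shows "\<bar>integral {a..a + real N * h} g - h * (\<Sum>m<N. g (a + real m * h))\<bar> \<le> K * h * (real N * h)"
  using assms(2)
proof (induction N)
  case 0
  then show ?case by simp
next
  case (Suc N)
  let ?p = "a + real N * h" and ?q = "a + real (Suc N) * h"
  have pq: "a \<le> ?p" "?p \<le> ?q" "?q - ?p = h"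
    using assms(1) by (auto simp: algebra_simps)
  have K: "K \<ge> 0" using Suc.prems lipschitz_on_nonneg by blast
  have cont: "continuous_on {a..?q} g" using Suc.prems lipschitz_on_continuous_on by blast
  have IH: "\<bar>integral {a..?p} g - h * (\<Sum>m<N. g (a + real m * h))\<bar> \<le> K * h * (real N * h)"
    using Suc.prems pq by (intro Suc.IH lipschitz_on_subset[OF Suc.prems]) auto
  have "\<bar>integral {?p..?q} g - integral {?p..?q} (\<lambda>_. g ?p)\<bar> \<le> (K * h) * (?q - ?p)"
  proof (rule integral_diff_bound)
    show "continuous_on {?p..?q} g" using pq by (intro continuous_on_subset[OF cont]) auto
    fix x assume x: "x \<in> {?p..?q}"
    have "x \<in> {a..?q}" "?p \<in> {a..?q}" using x pq(1,2) by auto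
    hence "\<bar>g x - g ?p\<bar> \<le> K * \<bar>x - ?p\<bar>"
      using lipschitz_onD[OF Suc.prems, of x ?p] unfolding dist_real_def by blast
    also have "\<dots> \<le> K * h" using x pq K by (intro mult_left_mono) auto
    finally show "\<bar>g x - g ?p\<bar> \<le> K * h" .
  qed (use pq in auto)
  hence "\<bar>integral {?p..?q} g - h * g ?p\<bar> \<le> K * h * h"
    using pq by simp
  moreover have "integral {a..?p} g + integral {?p..?q} g = integral {a..?q} g"
    using pq cont by (intro Henstock_Kurzweil_Integration.integral_combine integrable_continuous_real) auto
  ultimately have "\<bar>integral {a..?q} g - h * (\<Sum>m<Suc N. g (a + real m * h))\<bar>
      \<le> K * h * (real N * h) + K * h * h"
    using IH by (simp add: distrib_left)
  then show ?case by (simp add: algebra_simps)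
qed

text \<open>
  The exponent in \<^const>\<open>iota\<close> takes both signs, so the exponential is controlled only through an upper
  bound \<open>B\<close> for its arguments.
\<close>

lemma exp_lipschitz_below:
  fixes x y B :: real
  assumes "x \<le> B" and "y \<le> B"
  shows "\<bar>exp x - exp y\<bar> \<le> exp B * \<bar>x - y\<bar>"
proof -
  have "norm (exp x - exp y) \<le> exp B * norm (x - y)"
    by (rule field_differentiable_bound[where S="{..B}" and f'=exp])
       (use assms in \<open>auto intro: DERIV_exp has_field_derivative_at_within\<close>)
  thus ?thesis by simp
qed

section \<open>Lipschitz continuity of the absorption integrand\<close>

lemma rho_denominator_ge:
  fixes X a2 :: real
  assumes "a2 \<ge> 0" and "X \<ge> 0"
  shows "X\<^sup>2 + a2 * X + 1 \<ge> 1 + X\<^sup>2"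
  using mult_nonneg_nonneg[OF assms] by linarith

lemma rho_nonneg:
  assumes "a1 \<ge> 0" and "a2 \<ge> 0" and "X \<ge> 0"
  shows "0 \<le> rho a1 a2 X"
  using assms unfolding rho_def by simp

lemma rho_le:
  assumes "a1 \<ge> 0" and "a2 \<ge> 0" and "X \<ge> 0"
  shows "rho a1 a2 X \<le> a1"
proof -
  have "0 \<le> (X - 1)\<^sup>2" by simp
  hence "X \<le> 1 + X\<^sup>2" using assms(3) by (simp add: power2_eq_square algebra_simps)
  hence "X \<le> X\<^sup>2 + a2 * X + 1" using rho_denominator_ge[OF assms(2,3)] by linarith
  hence "a1 * X \<le> a1 * (X\<^sup>2 + a2 * X + 1)" using assms by (intro mult_left_mono) auto
  moreover have "X\<^sup>2 + a2 * X + 1 > 0"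
    using rho_denominator_ge[OF assms(2,3)] by (smt (verit) zero_le_power2)
  ultimately show ?thesis unfolding rho_def by (simp add: divide_le_eq)
qed

text \<open>
  Over a common denominator \<open>D X * D Y\<close> the difference is \<open>a1 * (X - Y) * (1 - X * Y)\<close>, and
  \<open>D X * D Y \<ge> (1 + X\<^sup>2) * (1 + Y\<^sup>2) \<ge> 1 + X * Y\<close>. Hence the slope \<open>a1\<close> at the origin is the largest.
\<close>

lemma rho_lipschitz:
  assumes "a1 \<ge> 0" and "a2 \<ge> 0" and "X \<ge> 0" and "Y \<ge> 0"
  shows "\<bar>rho a1 a2 X - rho a1 a2 Y\<bar> \<le> a1 * \<bar>X - Y\<bar>"
proof -
  let ?D = "\<lambda>X. X\<^sup>2 + a2 * X + 1"
  have D: "?D X \<ge> 1 + X\<^sup>2" "?D Y \<ge> 1 + Y\<^sup>2" using rho_denominator_ge assms by auto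
  hence pos: "?D X > 0" "?D Y > 0" by (smt (verit) zero_le_power2)+
  have eq: "rho a1 a2 X - rho a1 a2 Y = a1 * (X - Y) * ((1 - X * Y) / (?D X * ?D Y))"
    using pos unfolding rho_def by (simp add: field_simps power2_eq_square)
  have "0 \<le> (X - Y)\<^sup>2" "0 \<le> X\<^sup>2 * Y\<^sup>2" by simp_all
  moreover have "0 \<le> X * Y" using assms by simp
  ultimately have "\<bar>1 - X * Y\<bar> \<le> (1 + X\<^sup>2) * (1 + Y\<^sup>2)"
    by (simp add: power2_eq_square algebra_simps)
  also have "\<dots> \<le> ?D X * ?D Y" using D by (intro mult_mono) auto
  finally have "\<bar>(1 - X * Y) / (?D X * ?D Y)\<bar> \<le> 1"
    using pos by (simp add: abs_div divide_le_eq abs_mult)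
  hence "\<bar>a1 * (X - Y)\<bar> * \<bar>(1 - X * Y) / (?D X * ?D Y)\<bar> \<le> \<bar>a1 * (X - Y)\<bar>"
    by (intro mult_left_le) auto
  thus ?thesis unfolding eq using assms by (simp add: abs_mult)
qed

text \<open>
  The product rule for differences; it turns bounds and Lipschitz constants of two factors into a
  Lipschitz constant of their product.
\<close>

lemma abs_mult_diff_le:
  fixes p q r s :: real
  assumes "\<bar>p - r\<bar> \<le> d" and "\<bar>q - s\<bar> \<le> e" and "\<bar>q\<bar> \<le> A" and "\<bar>r\<bar> \<le> B"
  shows "\<bar>p * q - r * s\<bar> \<le> A * d + B * e"
proof -
  have "p * q - r * s = q * (p - r) + r * (q - s)" by (simp add: algebra_simps)
  hence "\<bar>p * q - r * s\<bar> \<le> \<bar>q\<bar> * \<bar>p - r\<bar> + \<bar>r\<bar> * \<bar>q - s\<bar>"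
    by (metis abs_mult abs_triangle_ineq)
  also have "\<dots> \<le> A * d + B * e" using assms by (intro add_mono mult_mono) auto
  finally show ?thesis .
qed

text \<open>
  The coefficients are bounded and Lipschitz by continuous differentiability. On a bounded range of
  \<open>y\<close> and \<open>s\<close> the exponent is therefore bounded by some \<open>H\<close> and Lipschitz in all its arguments, and the
  exponential of such a function is Lipschitz with a constant larger by the factor \<open>exp H\<close>.
\<close>

lemma iota_lipschitz:
  assumes I: "C1_on_interval l0 l1 I" "\<And>l. l \<in> {l0..l1} \<Longrightarrow> 0 \<le> I l \<and> I l \<le> 1"
    and \<epsilon>: "C1_on_interval l0 l1 \<epsilon>A" "C1_on_interval l0 l1 \<epsilon>B" and \<mu>: "\<mu> \<ge> 0" and B: "B \<ge> 0"
  obtains K where "K \<ge> 0"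
    and "\<And>l l' y y' s s'. \<lbrakk>l \<in> {l0..l1}; l' \<in> {l0..l1}; \<bar>y\<bar> \<le> B; \<bar>y'\<bar> \<le> B; \<bar>s\<bar> \<le> B; \<bar>s'\<bar> \<le> B\<rbrakk> \<Longrightarrow>
      \<bar>iota \<mu> I \<epsilon>A \<epsilon>B l y s - iota \<mu> I \<epsilon>A \<epsilon>B l' y' s'\<bar> \<le> K * (\<bar>l - l'\<bar> + \<bar>y - y'\<bar> + \<bar>s - s'\<bar>)"
proof -
  obtain kI where kI: "kI-lipschitz_on {l0..l1} I"
    using C1_on_interval_lipschitz_bounded[OF I(1)] by blast
  obtain kA eA where A: "kA-lipschitz_on {l0..l1} \<epsilon>A" "eA \<ge> 0" "\<And>l. l \<in> {l0..l1} \<Longrightarrow> \<bar>\<epsilon>A l\<bar> \<le> eA"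
    using C1_on_interval_lipschitz_bounded[OF \<epsilon>(1)] by blast
  obtain kB eB where B': "kB-lipschitz_on {l0..l1} \<epsilon>B" "eB \<ge> 0" "\<And>l. l \<in> {l0..l1} \<Longrightarrow> \<bar>\<epsilon>B l\<bar> \<le> eB"
    using C1_on_interval_lipschitz_bounded[OF \<epsilon>(2)] by blast
  have nn: "kI \<ge> 0" "kA \<ge> 0" "kB \<ge> 0" using kI A B' lipschitz_on_nonneg by blast+
  define e where "e = eA + eB"
  define k where "k = kA + kB"
  have e: "e \<ge> 0" and k: "k \<ge> 0" using A B' nn by (auto simp: e_def k_def)
  define H where "H = \<mu> * (B * e + B * e)"
  define kH where "kH = \<mu> * (2 * B * k + 2 * e)"
  define K where "K = exp H * kI + exp H * kH"
  have kH: "kH \<ge> 0"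
    unfolding kH_def using e k \<mu> B by (intro mult_nonneg_nonneg add_nonneg_nonneg) auto
  have K: "K \<ge> 0" using kH nn by (simp add: K_def)
  have "\<bar>iota \<mu> I \<epsilon>A \<epsilon>B l y s - iota \<mu> I \<epsilon>A \<epsilon>B l' y' s'\<bar> \<le> K * (\<bar>l - l'\<bar> + \<bar>y - y'\<bar> + \<bar>s - s'\<bar>)"
    if H0: "l \<in> {l0..l1}" "l' \<in> {l0..l1}" "\<bar>y\<bar> \<le> B" "\<bar>y'\<bar> \<le> B" "\<bar>s\<bar> \<le> B" "\<bar>s'\<bar> \<le> B" for l l' y y' s s'
  proof -
    let ?d = "\<bar>l - l'\<bar> + \<bar>y - y'\<bar> + \<bar>s - s'\<bar>"
    let ?h = "\<lambda>l y s. \<epsilon>B l * y + (\<epsilon>A l - \<epsilon>B l) * s"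
    have bnd: "\<bar>\<epsilon>B l\<bar> \<le> e" "\<bar>\<epsilon>A l - \<epsilon>B l\<bar> \<le> e" if "l \<in> {l0..l1}" for l
      using A(2) A(3)[OF that] B'(2) B'(3)[OF that] by (auto simp: e_def)
    have lipA: "\<bar>\<epsilon>A l - \<epsilon>A l'\<bar> \<le> kA * \<bar>l - l'\<bar>" and lipB: "\<bar>\<epsilon>B l - \<epsilon>B l'\<bar> \<le> kB * \<bar>l - l'\<bar>"
      and lipI: "\<bar>I l - I l'\<bar> \<le> kI * \<bar>l - l'\<bar>"
      using lipschitz_onD[OF A(1) H0(1,2)] lipschitz_onD[OF B'(1) H0(1,2)] lipschitz_onD[OF kI H0(1,2)]
      by (auto simp: dist_real_def)
    have h_ge: "- ?h l y s \<le> B * e + B * e" if "l \<in> {l0..l1}" "\<bar>y\<bar> \<le> B" "\<bar>s\<bar> \<le> B" for l y s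
    proof -
      have "\<bar>\<epsilon>B l * y\<bar> \<le> e * B" "\<bar>(\<epsilon>A l - \<epsilon>B l) * s\<bar> \<le> e * B"
        unfolding abs_mult using bnd[OF that(1)] that e by (intro mult_mono; simp)+
      thus ?thesis by (simp add: mult.commute)
    qed
    have lip_k: "\<bar>\<epsilon>B l - \<epsilon>B l'\<bar> \<le> k * \<bar>l - l'\<bar>"
      "\<bar>(\<epsilon>A l - \<epsilon>B l) - (\<epsilon>A l' - \<epsilon>B l')\<bar> \<le> k * \<bar>l - l'\<bar>"
      using lipA lipB mult_nonneg_nonneg[OF nn(2) abs_ge_zero[of "l - l'"]]
      unfolding k_def distrib_right by linarith+
    have "\<bar>\<epsilon>B l * y - \<epsilon>B l' * y'\<bar> \<le> B * (k * \<bar>l - l'\<bar>) + e * \<bar>y - y'\<bar>"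
      using lip_k(1) order_refl H0(3) bnd(1)[OF H0(2)] by (rule abs_mult_diff_le)
    moreover have "\<bar>(\<epsilon>A l - \<epsilon>B l) * s - (\<epsilon>A l' - \<epsilon>B l') * s'\<bar> \<le> B * (k * \<bar>l - l'\<bar>) + e * \<bar>s - s'\<bar>"
      using lip_k(2) order_refl H0(5) bnd(2)[OF H0(2)] by (rule abs_mult_diff_le)
    ultimately have "\<bar>?h l y s - ?h l' y' s'\<bar> \<le> 2 * B * k * \<bar>l - l'\<bar> + (e * \<bar>y - y'\<bar> + e * \<bar>s - s'\<bar>)"
      unfolding mult.assoc by linarith
    also have "\<dots> \<le> 2 * B * k * ?d + 2 * e * ?d"
    proof (rule add_mono)
      show "2 * B * k * \<bar>l - l'\<bar> \<le> 2 * B * k * ?d" using B k by (intro mult_left_mono) auto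
      have "e * (\<bar>y - y'\<bar> + \<bar>s - s'\<bar>) \<le> (2 * e) * ?d" using e by (intro mult_mono) auto
      thus "e * \<bar>y - y'\<bar> + e * \<bar>s - s'\<bar> \<le> 2 * e * ?d" by (simp add: distrib_left)
    qed
    also have "\<dots> = (2 * B * k + 2 * e) * ?d" by (rule distrib_right[symmetric])
    finally have "\<mu> * \<bar>?h l y s - ?h l' y' s'\<bar> \<le> \<mu> * ((2 * B * k + 2 * e) * ?d)"
      using \<mu> by (rule mult_left_mono)
    moreover have "\<bar>- \<mu> * p - - \<mu> * q\<bar> = \<mu> * \<bar>p - q\<bar>" for p q
      using \<mu> by (simp add: right_diff_distrib[symmetric] abs_mult abs_minus_commute)
    ultimately have h_lip: "\<bar>(- \<mu> * ?h l y s) - (- \<mu> * ?h l' y' s')\<bar> \<le> kH * ?d"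
      unfolding kH_def by (simp only: mult.assoc)
    have le_H: "- \<mu> * ?h l y s \<le> H" if "l \<in> {l0..l1}" "\<bar>y\<bar> \<le> B" "\<bar>s\<bar> \<le> B" for l y s
      using mult_left_mono[OF h_ge[OF that] \<mu>] unfolding H_def
      by (simp only: mult_minus_left mult_minus_right)
    have exp_lip: "\<bar>exp (- \<mu> * ?h l y s) - exp (- \<mu> * ?h l' y' s')\<bar> \<le> exp H * (kH * ?d)"
      using exp_lipschitz_below[OF le_H le_H, of l y s l' y' s'] h_lip H0
      by (meson exp_ge_zero mult_left_mono order_trans)
    have "\<bar>iota \<mu> I \<epsilon>A \<epsilon>B l y s - iota \<mu> I \<epsilon>A \<epsilon>B l' y' s'\<bar> \<le> exp H * (kI * \<bar>l - l'\<bar>) + 1 * (exp H * (kH * ?d))"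
      unfolding iota_def using lipI exp_lip H0 I(2)[of l'] le_H[of l y s]
      by (intro abs_mult_diff_le) auto
    also have "\<dots> \<le> exp H * (kI * ?d) + 1 * (exp H * (kH * ?d))"
      using nn kH by (intro add_mono mult_left_mono) auto
    finally show ?thesis by (simp add: K_def algebra_simps)
  qed
  with K show thesis using that by blast
qed

lemma rho_iota_lipschitz:
  assumes "C1_on_interval l0 l1 I" "\<And>l. l \<in> {l0..l1} \<Longrightarrow> 0 \<le> I l \<and> I l \<le> 1"
    and "C1_on_interval l0 l1 \<epsilon>A" "C1_on_interval l0 l1 \<epsilon>B" and "\<mu> \<ge> 0" and "B \<ge> 0"
    and "a1 \<ge> 0" and "a2 \<ge> 0"
  obtains K where "K \<ge> 0"
    and "\<And>l l' y y' s s'. \<lbrakk>l \<in> {l0..l1}; l' \<in> {l0..l1}; \<bar>y\<bar> \<le> B; \<bar>y'\<bar> \<le> B; \<bar>s\<bar> \<le> B; \<bar>s'\<bar> \<le> B\<rbrakk> \<Longrightarrow>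
      \<bar>rho a1 a2 (iota \<mu> I \<epsilon>A \<epsilon>B l y s) - rho a1 a2 (iota \<mu> I \<epsilon>A \<epsilon>B l' y' s')\<bar>
        \<le> K * (\<bar>l - l'\<bar> + \<bar>y - y'\<bar> + \<bar>s - s'\<bar>)"
proof -
  obtain K where K: "K \<ge> 0"
    "\<And>l l' y y' s s'. \<lbrakk>l \<in> {l0..l1}; l' \<in> {l0..l1}; \<bar>y\<bar> \<le> B; \<bar>y'\<bar> \<le> B; \<bar>s\<bar> \<le> B; \<bar>s'\<bar> \<le> B\<rbrakk> \<Longrightarrow>
      \<bar>iota \<mu> I \<epsilon>A \<epsilon>B l y s - iota \<mu> I \<epsilon>A \<epsilon>B l' y' s'\<bar> \<le> K * (\<bar>l - l'\<bar> + \<bar>y - y'\<bar> + \<bar>s - s'\<bar>)"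
    using iota_lipschitz[OF assms(1-6)] by blast
  have iota_nonneg: "iota \<mu> I \<epsilon>A \<epsilon>B l y s \<ge> 0" if "l \<in> {l0..l1}" for l y s
    using assms(2)[OF that] by (simp add: iota_def)
  show thesis
  proof (rule that[of "a1 * K"])
    fix l l' y y' s s'
    assume H: "l \<in> {l0..l1}" "l' \<in> {l0..l1}" "\<bar>y\<bar> \<le> B" "\<bar>y'\<bar> \<le> B" "\<bar>s\<bar> \<le> B" "\<bar>s'\<bar> \<le> B"
    show "\<bar>rho a1 a2 (iota \<mu> I \<epsilon>A \<epsilon>B l y s) - rho a1 a2 (iota \<mu> I \<epsilon>A \<epsilon>B l' y' s')\<bar>
        \<le> a1 * K * (\<bar>l - l'\<bar> + \<bar>y - y'\<bar> + \<bar>s - s'\<bar>)"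
      using rho_lipschitz[OF assms(7,8) iota_nonneg[OF H(1), of y s] iota_nonneg[OF H(2), of y' s']]
        mult_left_mono[OF K(2)[OF H] assms(7)] by simp
  qed (use K assms in auto)
qed

section \<open>Dissipative equations and the implicit step\<close>

text \<open>
  An energy estimate that replaces the explicit solution formula or Gronwall's lemma. Because \<open>r \<ge> 0\<close>,
  \<open>(d\<^sup>2)' = - 2 * r * d\<^sup>2 + 2 * d * g \<le> d\<^sup>2 + G\<^sup>2\<close>, so that \<open>exp (- t) * d\<^sup>2 - G\<^sup>2 * t\<close> does not increase.
\<close>

lemma dissipative_linear_ode_bound:
  fixes d g r :: "real \<Rightarrow> real"
  assumes deriv: "\<And>t. t \<in> {0..T} \<Longrightarrow> (d has_real_derivative - r t * d t + g t) (at t within {0..T})"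
    and r: "\<And>t. t \<in> {0..T} \<Longrightarrow> r t \<ge> 0" and g: "\<And>t. t \<in> {0..T} \<Longrightarrow> \<bar>g t\<bar> \<le> G"
    and t: "t \<in> {0..T}"
  shows "(d t)\<^sup>2 \<le> exp t * ((d 0)\<^sup>2 + G\<^sup>2 * t)"
proof -
  define w where "w = (\<lambda>t. exp (- t) * (d t)\<^sup>2 - G\<^sup>2 * t)"
  define w' where "w' = (\<lambda>t. exp (- t) * (2 * d t * (- r t * d t + g t) - (d t)\<^sup>2) - G\<^sup>2)"
  have w: "(w has_real_derivative w' s) (at s within {0..T})" if "s \<in> {0..T}" for s
    unfolding w_def w'_def
    by (rule derivative_eq_intros deriv[OF that] refl | simp)+ (simp add: algebra_simps)
  have w'_le: "w' s \<le> 0" if "s \<in> {0..T}" for s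
  proof -
    \<comment> \<open>The first square is Young's inequality for \<open>2 * d * g\<close>; the second is the dissipation.\<close>
    have "0 \<le> (d s - g s)\<^sup>2" "0 \<le> 2 * r s * (d s)\<^sup>2" using r[OF that] by auto
    hence "2 * d s * (- r s * d s + g s) - (d s)\<^sup>2 \<le> (g s)\<^sup>2"
      by (simp add: power2_eq_square algebra_simps)
    also have "\<dots> \<le> G\<^sup>2" using g[OF that] by (rule abs_le_square_iff[THEN iffD1, OF order_trans]) simp
    finally have "exp (- s) * (2 * d s * (- r s * d s + g s) - (d s)\<^sup>2) \<le> exp (- s) * G\<^sup>2"
      by (intro mult_left_mono) auto
    also have "\<dots> \<le> 1 * G\<^sup>2" using that by (intro mult_right_mono) auto
    finally show ?thesis by (simp add: w'_def)
  qed
  have "w t \<le> w 0"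
  proof (rule DERIV_nonpos_imp_decreasing_open[of 0 t])
    show "continuous_on {0..t} w"
      using t by (intro continuous_on_subset[OF DERIV_continuous_on[OF w]]) auto
  next
    fix x assume x: "0 < x" "x < t"
    have "(w has_real_derivative w' x) (at x)"
      using w[of x] x t by (simp add: at_within_Icc_at)
    thus "\<exists>y. (w has_real_derivative y) (at x) \<and> y \<le> 0" using w'_le[of x] x t by auto
  qed (use t in auto)
  hence "exp (- t) * (d t)\<^sup>2 \<le> (d 0)\<^sup>2 + G\<^sup>2 * t" by (simp add: w_def)
  hence "exp t * (exp (- t) * (d t)\<^sup>2) \<le> exp t * ((d 0)\<^sup>2 + G\<^sup>2 * t)" by (intro mult_left_mono) auto
  thus ?thesis by (simp add: mult.assoc[symmetric] exp_minus_inverse)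
qed

text \<open>
  Here \<open>c\<close> stands for the exact and \<open>u\<close> for the numerical value, \<open>P\<close> and \<open>Q\<close> for the exact and the
  discrete rate, \<open>h\<close> for the time step, \<open>k = \<phi> h\<close> and \<open>\<tau>\<close> for the truncation error. Since the scheme
  evaluates the decaying quantity at the new time, subtraction gives
  \<open>(1 + k * f * Q) * (c1 - u1) = (cn - un) + \<tau> + c1 * f * ((k - h) * Q + h * (Q - P))\<close>, and the factor on
  the left is at least \<open>1\<close> for every step size.
\<close>

lemma implicit_step_error:
  fixes cn c1 un u1 h k f P Q \<tau> :: real
  assumes exact: "c1 - cn = - h * (c1 * f * P) + \<tau>" and scheme: "u1 - un = - k * (u1 * f * Q)"
    and "k \<ge> 0" "f \<ge> 0" "Q \<ge> 0" "h \<ge> 0"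
  shows "\<bar>c1 - u1\<bar> \<le> \<bar>cn - un\<bar> + \<bar>\<tau>\<bar> + \<bar>c1\<bar> * f * (\<bar>k - h\<bar> * Q + h * \<bar>Q - P\<bar>)"
proof -
  have "(1 + k * f * Q) * (c1 - u1) = (cn - un) + \<tau> + c1 * f * ((k - h) * Q + h * (Q - P))"
    using exact scheme by algebra
  moreover have "\<bar>c1 - u1\<bar> \<le> \<bar>(1 + k * f * Q) * (c1 - u1)\<bar>"
  proof -
    have "1 * \<bar>c1 - u1\<bar> \<le> \<bar>1 + k * f * Q\<bar> * \<bar>c1 - u1\<bar>"
      using assms by (intro mult_right_mono) auto
    thus ?thesis by (simp add: abs_mult)
  qed
  moreover have "\<bar>c1 * f * ((k - h) * Q + h * (Q - P))\<bar> \<le> \<bar>c1\<bar> * f * (\<bar>k - h\<bar> * Q + h * \<bar>Q - P\<bar>)"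
  proof -
    have "\<bar>(k - h) * Q + h * (Q - P)\<bar> \<le> \<bar>k - h\<bar> * Q + h * \<bar>Q - P\<bar>"
      using assms by (metis abs_mult abs_of_nonneg abs_triangle_ineq)
    thus ?thesis using assms unfolding abs_mult by (intro mult_mono) auto
  qed
  ultimately show ?thesis by linarith
qed

text \<open>
  Unconditional stability of one step: the comparison with the exact solution \<open>0\<close>.
\<close>

lemma implicit_step_contracts:
  fixes un u1 k f Q :: real
  assumes "u1 - un = - k * (u1 * f * Q)" and "k \<ge> 0" "f \<ge> 0" "Q \<ge> 0"
  shows "\<bar>u1\<bar> \<le> \<bar>un\<bar>"
  using implicit_step_error[of 0 0 0 f 0 0, OF _ assms] by simp

section \<open>Regularity of the exact solution\<close>

lemma grid_in_interval:
  assumes "N > 0" and "j \<le> N" and "a \<ge> (0::real)"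
  shows "real j * (a / real N) \<in> {0..a}"
proof -
  have "real j * (a / real N) \<le> real N * (a / real N)"
    using assms by (intro mult_right_mono) auto
  thus ?thesis using assms by simp
qed

locale photochemical_model =
  fixes L T l0 l1 \<mu> a1 a2 :: real
    and f c0 I \<epsilon>A \<epsilon>B :: "real \<Rightarrow> real"
    and c :: "real \<Rightarrow> real \<Rightarrow> real"
  assumes L_pos: "L > 0" and T_pos: "T > 0" and l0_less_l1: "l0 < l1"
    and \<mu>_pos: "\<mu> > 0" and a1_pos: "a1 > 0" and a2_nonneg: "a2 \<ge> 0"
    and f_C1: "C1_on_interval 0 L f" and c0_C1: "C1_on_interval 0 L c0"
    and I_C1: "C1_on_interval l0 l1 I"
    and \<epsilon>A_C1: "C1_on_interval l0 l1 \<epsilon>A" and \<epsilon>B_C1: "C1_on_interval l0 l1 \<epsilon>B"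
    and f_nonneg: "\<And>x. x \<in> {0..L} \<Longrightarrow> f x \<ge> 0"
    and I_range: "\<And>l. l \<in> {l0..l1} \<Longrightarrow> 0 \<le> I l \<and> I l \<le> 1"
    and solution: "classical_solution L T l0 l1 \<mu> a1 a2 f c0 I \<epsilon>A \<epsilon>B c"
begin

text \<open>
  For fixed cumulative concentrations \<open>y\<close> (initial) and \<open>s\<close> (current), this is the integrand of the
  model as a function of the wavelength \<open>l\<close>.
\<close>

definition spectral :: "real \<Rightarrow> real \<Rightarrow> real \<Rightarrow> real" where
  "spectral l y s = rho a1 a2 (iota \<mu> I \<epsilon>A \<epsilon>B l y s)"

definition S :: "real \<Rightarrow> real \<Rightarrow> real" where
  "S x t = integral {0..x} (\<lambda>\<xi>. c \<xi> t)"

text \<open>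
  The decay rate without the factor \<open>f\<close>. The initial cumulative concentration is written as \<open>S x 0\<close>,
  so that every bound on \<open>S\<close> also applies to it.
\<close>

definition rate :: "real \<Rightarrow> real \<Rightarrow> real" where
  "rate x t = integral {l0..l1} (\<lambda>l. spectral l (S x 0) (S x t))"

definition discrete_rate :: "nat \<Rightarrow> real \<Rightarrow> real \<Rightarrow> real" where
  "discrete_rate Nl x s =
     (l1 - l0) / real Nl * (\<Sum>m<Nl. spectral (l0 + real m * ((l1 - l0) / real Nl)) (S x 0) s)"

lemma initial: "x \<in> {0..L} \<Longrightarrow> c x 0 = c0 x"
  using solution unfolding classical_solution_def by blast

lemma cumulative_eq_S: "x \<in> {0..L} \<Longrightarrow> cumulative c0 x = S x 0"
  unfolding cumulative_def S_def by (intro integral_cong) (simp add: initial)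

text \<open>
  The model in the abbreviated form \<open>c\<^sub>t = - c * f * rate\<close> in which it is used from here on.
\<close>

lemma c_deriv:
  assumes "x \<in> {0..L}" "t \<in> {0..T}"
  shows "(c x has_real_derivative - c x t * f x * rate x t) (at t within {0..T})"
proof -
  have "((\<lambda>s. c x s) has_real_derivative
           - c x t * f x *
             integral {l0..l1}
               (\<lambda>l. rho a1 a2 (iota \<mu> I \<epsilon>A \<epsilon>B l (cumulative c0 x) (integral {0..x} (\<lambda>\<xi>. c \<xi> t)))))
        (at t within {0..T})"
    using solution assms unfolding classical_solution_def by blast
  thus ?thesis
    unfolding rate_def spectral_def cumulative_eq_S[OF assms(1)] S_def .
qed

lemma continuous_in_x: "t \<in> {0..T} \<Longrightarrow> continuous_on {0..L} (\<lambda>x. c x t)"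
proof -
  assume t: "t \<in> {0..T}"
  have "continuous_on ({0..L} \<times> {0..T}) (\<lambda>(x, t). c x t)"
    using solution unfolding classical_solution_def by blast
  hence "continuous_on {0..L} ((\<lambda>(x, t). c x t) \<circ> (\<lambda>x. (x, t)))"
    using t by (intro continuous_on_compose continuous_intros) (auto elim: continuous_on_subset)
  thus ?thesis by (simp add: o_def)
qed

lemma c_bounded:
  obtains M where "M > 0" "\<And>x t. \<lbrakk>x \<in> {0..L}; t \<in> {0..T}\<rbrakk> \<Longrightarrow> \<bar>c x t\<bar> \<le> M"
proof -
  have "continuous_on ({0..L} \<times> {0..T}) (\<lambda>(x, t). c x t)"
    using solution unfolding classical_solution_def by blast
  hence "bounded ((\<lambda>(x, t). c x t) ` ({0..L} \<times> {0..T}))"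
    by (intro compact_imp_bounded compact_continuous_image compact_Times) auto
  then obtain M where "M > 0" "\<And>p. p \<in> {0..L} \<times> {0..T} \<Longrightarrow> \<bar>case p of (x, t) \<Rightarrow> c x t\<bar> \<le> M"
    by (auto simp: bounded_pos)
  thus thesis using that[of M] by (metis SigmaI case_prod_conv)
qed

lemma S_bounded:
  assumes M: "\<And>x t. \<lbrakk>x \<in> {0..L}; t \<in> {0..T}\<rbrakk> \<Longrightarrow> \<bar>c x t\<bar> \<le> M" "M \<ge> 0"
    and "x \<in> {0..L}" "t \<in> {0..T}"
  shows "\<bar>S x t\<bar> \<le> M * L"
proof -
  have "norm (S x t) \<le> M * (x - 0)"
    unfolding S_def using assms
    by (intro integral_bound continuous_on_subset[OF continuous_in_x]) auto
  also have "\<dots> \<le> M * L" using assms by (intro mult_left_mono) auto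
  finally show ?thesis by simp
qed

lemma S_lipschitz_x:
  assumes M: "\<And>x t. \<lbrakk>x \<in> {0..L}; t \<in> {0..T}\<rbrakk> \<Longrightarrow> \<bar>c x t\<bar> \<le> M"
    and "x \<in> {0..L}" "y \<in> {0..L}" "t \<in> {0..T}"
  shows "\<bar>S x t - S y t\<bar> \<le> M * \<bar>x - y\<bar>"
proof -
  have main: "\<bar>S y t - S x t\<bar> \<le> M * (y - x)" if "x \<in> {0..L}" "y \<in> {0..L}" "x \<le> y" for x y
  proof -
    have cont: "continuous_on {0..y} (\<lambda>\<xi>. c \<xi> t)"
      using that assms(4) by (intro continuous_on_subset[OF continuous_in_x]) auto
    have "S x t + integral {x..y} (\<lambda>\<xi>. c \<xi> t) = S y t"
      unfolding S_def using that cont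
      by (intro Henstock_Kurzweil_Integration.integral_combine integrable_continuous_real) auto
    moreover have "norm (integral {x..y} (\<lambda>\<xi>. c \<xi> t)) \<le> M * (y - x)"
      using that assms(4) by (intro integral_bound continuous_on_subset[OF cont]) (auto intro!: M)
    ultimately show ?thesis by (simp add: algebra_simps)
  qed
  show ?thesis
    using main[of x y] main[of y x] assms by (cases "x \<le> y") (auto simp: abs_minus_commute)
qed

lemma S_lipschitz_t:
  assumes K: "\<And>x t t'. \<lbrakk>x \<in> {0..L}; t \<in> {0..T}; t' \<in> {0..T}\<rbrakk> \<Longrightarrow> \<bar>c x t - c x t'\<bar> \<le> K * \<bar>t - t'\<bar>"
    and "K \<ge> 0" "x \<in> {0..L}" "t \<in> {0..T}" "t' \<in> {0..T}"
  shows "\<bar>S x t - S x t'\<bar> \<le> K * L * \<bar>t - t'\<bar>"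
proof -
  have "\<bar>S x t - S x t'\<bar> \<le> (K * \<bar>t - t'\<bar>) * (x - 0)"
    unfolding S_def using assms
    by (intro integral_diff_bound continuous_on_subset[OF continuous_in_x]) auto
  also have "\<dots> \<le> (K * \<bar>t - t'\<bar>) * L" using assms by (intro mult_left_mono) auto
  finally show ?thesis by (simp add: mult_ac)
qed

lemma spectral_range:
  assumes "l \<in> {l0..l1}"
  shows "0 \<le> spectral l y s" "spectral l y s \<le> a1"
proof -
  have "iota \<mu> I \<epsilon>A \<epsilon>B l y s \<ge> 0" using I_range[OF assms] by (simp add: iota_def)
  thus "0 \<le> spectral l y s" "spectral l y s \<le> a1"
    unfolding spectral_def using rho_nonneg rho_le a1_pos a2_nonneg by auto
qed

text \<open>
  The Lipschitz constant depends on the range \<open>B\<close> of the cumulative concentrations; in the convergence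
  proof, \<open>B = M * L\<close>
  bounds those of the exact and of the numerical solution alike.
\<close>

lemma spectral_lipschitz:
  assumes "B \<ge> 0"
  obtains K where "K \<ge> 0"
    and "\<And>l l' y y' s s'. \<lbrakk>l \<in> {l0..l1}; l' \<in> {l0..l1}; \<bar>y\<bar> \<le> B; \<bar>y'\<bar> \<le> B; \<bar>s\<bar> \<le> B; \<bar>s'\<bar> \<le> B\<rbrakk> \<Longrightarrow>
      \<bar>spectral l y s - spectral l' y' s'\<bar> \<le> K * (\<bar>l - l'\<bar> + \<bar>y - y'\<bar> + \<bar>s - s'\<bar>)"
  unfolding spectral_def
  using rho_iota_lipschitz[OF I_C1 I_range \<epsilon>A_C1 \<epsilon>B_C1 _ assms] \<mu>_pos a1_pos a2_nonneg
  by (metis less_imp_le)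

lemma spectral_continuous_on:
  "continuous_on {l0..l1} (\<lambda>l. spectral l y s)"
proof -
  define B where "B = \<bar>y\<bar> + \<bar>s\<bar>"
  have B: "B \<ge> 0" "\<bar>y\<bar> \<le> B" "\<bar>s\<bar> \<le> B" by (auto simp: B_def)
  obtain K where K: "K \<ge> 0"
    "\<And>l l' y y' s s'. \<lbrakk>l \<in> {l0..l1}; l' \<in> {l0..l1}; \<bar>y\<bar> \<le> B; \<bar>y'\<bar> \<le> B; \<bar>s\<bar> \<le> B; \<bar>s'\<bar> \<le> B\<rbrakk> \<Longrightarrow>
      \<bar>spectral l y s - spectral l' y' s'\<bar> \<le> K * (\<bar>l - l'\<bar> + \<bar>y - y'\<bar> + \<bar>s - s'\<bar>)"
    using spectral_lipschitz[OF B(1)] by metis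
  have "K-lipschitz_on {l0..l1} (\<lambda>l. spectral l y s)"
    using K(2)[OF _ _ B(2,2,3,3)] K(1) by (intro lipschitz_onI) (auto simp: dist_real_def)
  thus ?thesis by (rule lipschitz_on_continuous_on)
qed

lemma wavelength_node:
  assumes "m < Nl"
  shows "l0 + real m * ((l1 - l0) / real Nl) \<in> {l0..l1}"
proof -
  have "real m * ((l1 - l0) / real Nl) \<in> {0..l1 - l0}"
    using assms l0_less_l1 by (intro grid_in_interval) auto
  thus ?thesis by auto
qed

lemma discrete_rate_range:
  assumes "Nl > 0"
  shows "0 \<le> discrete_rate Nl x s" "discrete_rate Nl x s \<le> a1 * (l1 - l0)"
proof -
  let ?h = "(l1 - l0) / real Nl"
  have h: "?h > 0" using l0_less_l1 assms by simp
  have "(\<Sum>m<Nl. spectral (l0 + real m * ?h) (S x 0) s) \<ge> 0"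
    by (intro sum_nonneg spectral_range wavelength_node) simp
  thus "0 \<le> discrete_rate Nl x s"
    unfolding discrete_rate_def using h by (intro mult_nonneg_nonneg) auto
  have "(\<Sum>m<Nl. spectral (l0 + real m * ?h) (S x 0) s) \<le> (\<Sum>m<Nl. a1)"
    by (intro sum_mono spectral_range wavelength_node) simp
  hence "discrete_rate Nl x s \<le> ?h * (\<Sum>m<Nl. a1)"
    unfolding discrete_rate_def using h by (intro mult_left_mono) auto
  also have "?h * (\<Sum>m<Nl. a1) = a1 * (l1 - l0)" using assms by simp
  finally show "discrete_rate Nl x s \<le> a1 * (l1 - l0)" .
qed

end

text \<open>
  The step-independent constants of the convergence proof: bounds and Lipschitz constants of the exact
  solution and of the rate. Fixing them once makes it evident that the final error constant does not
  depend on the grid.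
\<close>

locale regular_solution = photochemical_model +
  fixes M F K Ct Cx Rt :: real
  assumes M_pos: "M > 0" and F_nonneg: "F \<ge> 0" and K_nonneg: "K \<ge> 0"
    and Ct_nonneg: "Ct \<ge> 0" and Rt_nonneg: "Rt \<ge> 0"
    and c_le: "\<And>x t. \<lbrakk>x \<in> {0..L}; t \<in> {0..T}\<rbrakk> \<Longrightarrow> \<bar>c x t\<bar> \<le> M"
    and f_le: "\<And>x. x \<in> {0..L} \<Longrightarrow> f x \<le> F"
    and spectral_lip:
      "\<And>l l' y y' s s'. \<lbrakk>l \<in> {l0..l1}; l' \<in> {l0..l1}; \<bar>y\<bar> \<le> M * L; \<bar>y'\<bar> \<le> M * L; \<bar>s\<bar> \<le> M * L; \<bar>s'\<bar> \<le> M * L\<rbrakk> \<Longrightarrow>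
      \<bar>spectral l y s - spectral l' y' s'\<bar> \<le> K * (\<bar>l - l'\<bar> + \<bar>y - y'\<bar> + \<bar>s - s'\<bar>)"
    and rate_range: "\<And>x t. \<lbrakk>x \<in> {0..L}; t \<in> {0..T}\<rbrakk> \<Longrightarrow> 0 \<le> rate x t \<and> rate x t \<le> a1 * (l1 - l0)"
    and c_lip_t: "\<And>x t t'. \<lbrakk>x \<in> {0..L}; t \<in> {0..T}; t' \<in> {0..T}\<rbrakk> \<Longrightarrow> \<bar>c x t - c x t'\<bar> \<le> Ct * \<bar>t - t'\<bar>"
    and rate_lip_t: "\<And>x t t'. \<lbrakk>x \<in> {0..L}; t \<in> {0..T}; t' \<in> {0..T}\<rbrakk> \<Longrightarrow> \<bar>rate x t - rate x t'\<bar> \<le> Rt * \<bar>t - t'\<bar>"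
    and c_lip_x: "\<And>t. t \<in> {0..T} \<Longrightarrow> Cx-lipschitz_on {0..L} (\<lambda>x. c x t)"

text \<open>
  The bound \<open>M\<close> comes from compactness of the rectangle and makes \<open>S\<close> Lipschitz in \<open>x\<close>, hence also the
  rate. The differential equation then bounds \<open>c\<^sub>t\<close>, which makes \<open>c\<close>, \<open>S\<close> and the rate Lipschitz in \<open>t\<close>.
  Regularity of \<open>c\<close> in \<open>x\<close> is not part of the notion of a solution: the difference of the solution at
  two places \<open>x\<close> and \<open>y\<close> satisfies a dissipative linear equation in time whose initial value and forcing
  are both of size \<open>\<bar>x - y\<bar>\<close>, because \<open>c0\<close>, \<open>f\<close> and the rate are Lipschitz in \<open>x\<close>.
\<close>

lemma (in photochemical_model) solution_regularity:
  "\<exists>M F K Ct Cx Rt. regular_solution L T l0 l1 \<mu> a1 a2 f c0 I \<epsilon>A \<epsilon>B c M F K Ct Cx Rt"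
proof -
  obtain M where M: "M > 0" "\<And>x t. \<lbrakk>x \<in> {0..L}; t \<in> {0..T}\<rbrakk> \<Longrightarrow> \<bar>c x t\<bar> \<le> M"
    using c_bounded by blast
  obtain kf F where f: "kf-lipschitz_on {0..L} f" "F \<ge> 0" "\<And>x. x \<in> {0..L} \<Longrightarrow> \<bar>f x\<bar> \<le> F"
    using C1_on_interval_lipschitz_bounded[OF f_C1] by blast
  obtain k0 where k0: "k0-lipschitz_on {0..L} c0"
    using C1_on_interval_lipschitz_bounded[OF c0_C1] by blast
  have f_le: "f x \<le> F" if "x \<in> {0..L}" for x using f(3)[OF that] by simp
  have nn: "kf \<ge> 0" "k0 \<ge> 0" using f k0 lipschitz_on_nonneg by auto
  define B where "B = M * L"
  define D where "D = l1 - l0"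
  have B: "B \<ge> 0" and D: "D > 0" using M L_pos l0_less_l1 by (auto simp: B_def D_def)
  obtain K where K: "K \<ge> 0"
    "\<And>l l' y y' s s'. \<lbrakk>l \<in> {l0..l1}; l' \<in> {l0..l1}; \<bar>y\<bar> \<le> B; \<bar>y'\<bar> \<le> B; \<bar>s\<bar> \<le> B; \<bar>s'\<bar> \<le> B\<rbrakk> \<Longrightarrow>
      \<bar>spectral l y s - spectral l' y' s'\<bar> \<le> K * (\<bar>l - l'\<bar> + \<bar>y - y'\<bar> + \<bar>s - s'\<bar>)"
    using spectral_lipschitz[OF B] by metis
  have S: "\<bar>S x t\<bar> \<le> B" if "x \<in> {0..L}" "t \<in> {0..T}" for x t
    using S_bounded[OF M(2) _ that] M(1) by (simp add: B_def)
  have zero_T: "0 \<in> {0..T}" using T_pos by simp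
  have rate_diff: "\<bar>rate x t - rate y t'\<bar> \<le> K * D * (\<bar>S x 0 - S y 0\<bar> + \<bar>S x t - S y t'\<bar>)"
    if "x \<in> {0..L}" "t \<in> {0..T}" "y \<in> {0..L}" "t' \<in> {0..T}" for x t y t'
  proof -
    have "\<bar>rate x t - rate y t'\<bar> \<le> (K * (\<bar>S x 0 - S y 0\<bar> + \<bar>S x t - S y t'\<bar>)) * (l1 - l0)"
      unfolding rate_def
    proof (rule integral_diff_bound)
      fix l assume "l \<in> {l0..l1}"
      from K(2)[OF this this S[OF that(1) zero_T] S[OF that(3) zero_T] S[OF that(1,2)] S[OF that(3,4)]]
      show "\<bar>spectral l (S x 0) (S x t) - spectral l (S y 0) (S y t')\<bar> \<le> K * (\<bar>S x 0 - S y 0\<bar> + \<bar>S x t - S y t'\<bar>)"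
        by simp
    qed (use spectral_continuous_on l0_less_l1 in auto)
    thus ?thesis by (simp add: D_def mult_ac)
  qed
  have rate_range: "0 \<le> rate x t \<and> rate x t \<le> a1 * D" if "x \<in> {0..L}" "t \<in> {0..T}" for x t
  proof
    show "0 \<le> rate x t" unfolding rate_def
      using spectral_continuous_on spectral_range by (intro integral_nonneg integrable_continuous_real) auto
    have "norm (rate x t) \<le> a1 * (l1 - l0)" unfolding rate_def
      using spectral_continuous_on spectral_range l0_less_l1 by (intro integral_bound) auto
    thus "rate x t \<le> a1 * D" by (simp add: D_def)
  qed
  define A where "A = a1 * D"
  have A: "A \<ge> 0" using a1_pos D by (simp add: A_def)
  define Ct where "Ct = M * F * A"
  have Ct: "Ct \<ge> 0" using M f A by (simp add: Ct_def)
  have c_t: "\<bar>c x t - c x t'\<bar> \<le> Ct * \<bar>t - t'\<bar>" if "x \<in> {0..L}" "t \<in> {0..T}" "t' \<in> {0..T}" for x t t'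
  proof -
    have "norm (c x t - c x t') \<le> Ct * norm (t - t')"
    proof (rule field_differentiable_bound[OF _ c_deriv])
      fix s assume s: "s \<in> {0..T}"
      have "\<bar>c x s\<bar> * \<bar>f x\<bar> * \<bar>rate x s\<bar> \<le> M * F * A"
        using M f rate_range[OF that(1) s] s that A by (intro mult_mono) (auto simp: A_def)
      thus "norm (- c x s * f x * rate x s) \<le> Ct" by (simp add: abs_mult Ct_def)
    qed (use that in auto)
    thus ?thesis by simp
  qed
  define Rt where "Rt = K * D * (Ct * L)"
  have Rt: "Rt \<ge> 0" using K D Ct L_pos by (simp add: Rt_def)
  have rate_t: "\<bar>rate x t - rate x t'\<bar> \<le> Rt * \<bar>t - t'\<bar>" if "x \<in> {0..L}" "t \<in> {0..T}" "t' \<in> {0..T}" for x t t'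
  proof -
    have "\<bar>rate x t - rate x t'\<bar> \<le> K * D * \<bar>S x t - S x t'\<bar>"
      using rate_diff[OF that(1,2,1,3)] by simp
    also have "\<dots> \<le> K * D * (Ct * L * \<bar>t - t'\<bar>)"
      using K D S_lipschitz_t[OF c_t Ct that] by (intro mult_left_mono) auto
    finally show ?thesis by (simp add: Rt_def mult_ac)
  qed
  define Rx where "Rx = K * D * (2 * M)"
  have Rx: "Rx \<ge> 0" using K D M by (simp add: Rx_def)
  have rate_x: "\<bar>rate x t - rate y t\<bar> \<le> Rx * \<bar>x - y\<bar>" if "x \<in> {0..L}" "y \<in> {0..L}" "t \<in> {0..T}" for x y t
  proof -
    have "\<bar>rate x t - rate y t\<bar> \<le> K * D * (\<bar>S x 0 - S y 0\<bar> + \<bar>S x t - S y t\<bar>)"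
      using rate_diff[OF that(1,3,2,3)] .
    also have "\<dots> \<le> K * D * (M * \<bar>x - y\<bar> + M * \<bar>x - y\<bar>)"
      using K D that zero_T by (intro mult_left_mono add_mono S_lipschitz_x[OF M(2)]) auto
    finally show ?thesis by (simp add: Rx_def mult_ac)
  qed
  define G where "G = M * (A * kf + F * Rx)"
  \<comment> \<open>The energy estimate at \<open>t = T\<close>, with \<open>k0\<close> and \<open>G\<close> the bounds, per unit of \<open>\<bar>x - y\<bar>\<close>, of the
    initial value and of the forcing.\<close>
  define Cx where "Cx = sqrt (exp T * (k0\<^sup>2 + G\<^sup>2 * T))"
  have Cx: "Cx \<ge> 0" using T_pos by (simp add: Cx_def)
  have c_x: "Cx-lipschitz_on {0..L} (\<lambda>x. c x t)" if t: "t \<in> {0..T}" for t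
  proof (rule lipschitz_onI[OF _ Cx])
    fix x y assume xy: "x \<in> {0..L}" "y \<in> {0..L}"
    let ?d = "\<lambda>s. c x s - c y s"
    \<comment> \<open>Splitting off \<open>f x * rate x s\<close> leaves a nonnegative damping coefficient; the rest is forcing.\<close>
    let ?g = "\<lambda>s. c y s * (f y * rate y s - f x * rate x s)"
    have "(?d t)\<^sup>2 \<le> exp t * ((?d 0)\<^sup>2 + (G * \<bar>x - y\<bar>)\<^sup>2 * t)"
    proof (rule dissipative_linear_ode_bound[OF _ _ _ t])
      fix s assume s: "s \<in> {0..T}"
      have "(?d has_real_derivative - c x s * f x * rate x s - (- c y s * f y * rate y s)) (at s within {0..T})"
        by (intro DERIV_diff c_deriv xy s)
      thus "(?d has_real_derivative - (f x * rate x s) * ?d s + ?g s) (at s within {0..T})"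
        by (simp add: algebra_simps)
      show "f x * rate x s \<ge> 0" using f_nonneg rate_range xy s by simp
      have "\<bar>f y * rate y s - f x * rate x s\<bar> \<le> A * (kf * \<bar>x - y\<bar>) + F * (Rx * \<bar>x - y\<bar>)"
        using lipschitz_onD[OF f(1) xy(2,1)] rate_x[OF xy(2,1) s] rate_range[OF xy(2) s] f(3)[OF xy(1)]
        by (intro abs_mult_diff_le) (auto simp: dist_real_def abs_minus_commute A_def)
      hence "\<bar>?g s\<bar> \<le> M * (A * (kf * \<bar>x - y\<bar>) + F * (Rx * \<bar>x - y\<bar>))"
        unfolding abs_mult using M(1) M(2)[OF xy(2) s] by (intro mult_mono) auto
      thus "\<bar>?g s\<bar> \<le> G * \<bar>x - y\<bar>" by (simp add: G_def algebra_simps)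
    qed
    also have "\<dots> \<le> exp T * ((k0 * \<bar>x - y\<bar>)\<^sup>2 + (G * \<bar>x - y\<bar>)\<^sup>2 * T)"
    proof (intro mult_mono add_mono)
      have "\<bar>?d 0\<bar> \<le> k0 * \<bar>x - y\<bar>"
        using lipschitz_onD[OF k0 xy] initial xy by (simp add: dist_real_def)
      thus "(?d 0)\<^sup>2 \<le> (k0 * \<bar>x - y\<bar>)\<^sup>2" using nn by (simp add: abs_le_square_iff[symmetric])
    qed (use t in auto)
    also have "\<dots> = (Cx * \<bar>x - y\<bar>)\<^sup>2"
      using T_pos by (simp add: Cx_def power_mult_distrib algebra_simps)
    finally have "\<bar>?d t\<bar> \<le> \<bar>Cx * \<bar>x - y\<bar>\<bar>" by (simp add: abs_le_square_iff)
    thus "dist (c x t) (c y t) \<le> Cx * dist x y" using Cx by (simp add: dist_real_def abs_mult)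
  qed
  have "regular_solution L T l0 l1 \<mu> a1 a2 f c0 I \<epsilon>A \<epsilon>B c M F K Ct Cx Rt"
    using M K Ct Rt f(2) f_le rate_range c_t rate_t c_x
    by unfold_locales (auto simp: B_def D_def)
  thus ?thesis by blast
qed

section \<open>Consistency and error propagation\<close>

context regular_solution
begin

lemma Cx_nonneg: "Cx \<ge> 0"
  using c_lip_x[of 0] T_pos lipschitz_on_nonneg by fastforce

lemma S_le: "\<lbrakk>x \<in> {0..L}; t \<in> {0..T}\<rbrakk> \<Longrightarrow> \<bar>S x t\<bar> \<le> M * L"
  using S_bounded c_le M_pos by (metis less_imp_le)

lemma discrete_rate_diff:
  assumes "Nl > 0" and "x \<in> {0..L}" and "\<bar>s\<bar> \<le> M * L" and "\<bar>s'\<bar> \<le> M * L"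
  shows "\<bar>discrete_rate Nl x s - discrete_rate Nl x s'\<bar> \<le> K * (l1 - l0) * \<bar>s - s'\<bar>"
proof -
  let ?h = "(l1 - l0) / real Nl"
  let ?p = "\<lambda>m s. spectral (l0 + real m * ?h) (S x 0) s"
  have h: "?h > 0" using l0_less_l1 assms by simp
  have "\<bar>\<Sum>m<Nl. ?p m s - ?p m s'\<bar> \<le> (\<Sum>m<Nl. K * \<bar>s - s'\<bar>)"
  proof (rule order_trans[OF sum_abs sum_mono])
    fix m assume m: "m \<in> {..<Nl}"
    have S0: "\<bar>S x 0\<bar> \<le> M * L" using S_le assms T_pos by simp
    show "\<bar>?p m s - ?p m s'\<bar> \<le> K * \<bar>s - s'\<bar>"
      using spectral_lip[OF wavelength_node wavelength_node S0 S0 assms(3,4), of m Nl m Nl] m by simp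
  qed
  hence "?h * \<bar>\<Sum>m<Nl. ?p m s - ?p m s'\<bar> \<le> ?h * (real Nl * (K * \<bar>s - s'\<bar>))"
    using h by (intro mult_left_mono) auto
  moreover have "discrete_rate Nl x s - discrete_rate Nl x s' = ?h * (\<Sum>m<Nl. ?p m s - ?p m s')"
    unfolding discrete_rate_def by (simp only: sum_subtractf right_diff_distrib)
  moreover have "?h * (real Nl * (K * \<bar>s - s'\<bar>)) = K * (l1 - l0) * \<bar>s - s'\<bar>"
    using assms(1) by simp
  ultimately show ?thesis by (simp only: abs_mult abs_of_pos[OF h])
qed

lemma spectral_quadrature_error:
  assumes "Nl > 0" and "x \<in> {0..L}" and "t \<in> {0..T}"
  shows "\<bar>rate x t - discrete_rate Nl x (S x t)\<bar> \<le> K * (l1 - l0) * ((l1 - l0) / real Nl)"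
proof -
  let ?h = "(l1 - l0) / real Nl"
  have Nh: "real Nl * ?h = l1 - l0" using assms(1) by simp
  have S: "\<bar>S x 0\<bar> \<le> M * L" "\<bar>S x t\<bar> \<le> M * L" using S_le assms T_pos by auto
  have "K-lipschitz_on {l0..l1} (\<lambda>l. spectral l (S x 0) (S x t))"
    using spectral_lip[OF _ _ S(1,1,2,2)] K_nonneg by (intro lipschitz_onI) (auto simp: dist_real_def)
  hence "K-lipschitz_on {l0..l0 + real Nl * ?h} (\<lambda>l. spectral l (S x 0) (S x t))"
    unfolding Nh by simp
  from left_riemann_sum_error[OF _ this] show ?thesis
    unfolding rate_def discrete_rate_def Nh using l0_less_l1 by (simp add: mult_ac)
qed

text \<open>
  Two errors meet here: the left Riemann sum of the exact values, which costs \<open>Cx * h\<close> per unit length,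
  and the replacement of the exact by the numerical values, which costs \<open>E\<close> per unit length. The second
  couples the error at one grid point to the errors at all points to its left.
\<close>

lemma cumulative_quadrature_error:
  assumes "h > 0" and "real j * h \<le> L" and "t \<in> {0..T}" and "E \<ge> 0"
    and "\<And>r. r < j \<Longrightarrow> \<bar>c (real r * h) t - v r\<bar> \<le> E"
  shows "\<bar>S (real j * h) t - h * (\<Sum>r<j. v r)\<bar> \<le> L * (Cx * h + E)"
proof -
  have "\<bar>S (real j * h) t - h * (\<Sum>r<j. c (real r * h) t)\<bar> \<le> Cx * h * (real j * h)"
    using left_riemann_sum_error[of h Cx 0 j "\<lambda>x. c x t"] assms
      lipschitz_on_subset[OF c_lip_x[OF assms(3)], of "{0..real j * h}"]
    by (auto simp: S_def)
  moreover have "\<bar>h * (\<Sum>r<j. c (real r * h) t) - h * (\<Sum>r<j. v r)\<bar> \<le> h * (real j * E)"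
  proof -
    have "\<bar>\<Sum>r<j. c (real r * h) t - v r\<bar> \<le> (\<Sum>r<j. E)"
      using assms by (intro order_trans[OF sum_abs sum_mono]) auto
    hence "h * \<bar>\<Sum>r<j. c (real r * h) t - v r\<bar> \<le> h * (real j * E)"
      using assms by (intro mult_left_mono) auto
    thus ?thesis using assms by (simp add: sum_subtractf right_diff_distrib[symmetric] abs_mult)
  qed
  ultimately have "\<bar>S (real j * h) t - h * (\<Sum>r<j. v r)\<bar> \<le> (real j * h) * (Cx * h + E)"
    by (simp add: algebra_simps)
  also have "\<dots> \<le> L * (Cx * h + E)"
    using assms Cx_nonneg by (intro mult_right_mono) auto
  finally show ?thesis .
qed

text \<open>
  Inserting \<open>discrete_rate Nl x (S x t)\<close> separates the wavelength quadrature from the error in the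
  cumulative concentration. The bound \<open>M\<close> on the numerical values keeps that concentration in the
  range on which \<open>spectral_lip\<close> holds.
\<close>

lemma discrete_rate_error:
  assumes "h > 0" and "real j * h \<le> L" and "t \<in> {0..T}" and "Nl > 0" and "E \<ge> 0"
    and v: "\<And>r. r < j \<Longrightarrow> \<bar>v r\<bar> \<le> M" "\<And>r. r < j \<Longrightarrow> \<bar>c (real r * h) t - v r\<bar> \<le> E"
  shows "\<bar>discrete_rate Nl (real j * h) (h * (\<Sum>r<j. v r)) - rate (real j * h) t\<bar>
    \<le> K * (l1 - l0) * ((l1 - l0) / real Nl + L * (Cx * h + E))"
proof -
  let ?x = "real j * h" and ?s = "h * (\<Sum>r<j. v r)"
  have x: "?x \<in> {0..L}" using assms by simp
  have "\<bar>\<Sum>r<j. v r\<bar> \<le> (\<Sum>r<j. M)" using v(1) by (intro order_trans[OF sum_abs sum_mono]) auto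
  hence "\<bar>?s\<bar> \<le> h * (real j * M)" using assms(1) by (simp add: abs_mult)
  also have "\<dots> = ?x * M" by simp
  also have "\<dots> \<le> L * M" using M_pos assms by (intro mult_right_mono) auto
  finally have s: "\<bar>?s\<bar> \<le> M * L" by (simp add: mult.commute)
  have KD: "K * (l1 - l0) \<ge> 0" using K_nonneg l0_less_l1 by simp
  have "\<bar>discrete_rate Nl ?x (S ?x t) - discrete_rate Nl ?x ?s\<bar> \<le> K * (l1 - l0) * \<bar>S ?x t - ?s\<bar>"
    by (rule discrete_rate_diff[OF assms(4) x S_le[OF x assms(3)] s])
  also have "\<dots> \<le> K * (l1 - l0) * (L * (Cx * h + E))"
    using cumulative_quadrature_error[OF assms(1,2,3,5) v(2)] KD by (rule mult_left_mono)
  finally show ?thesis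
    using spectral_quadrature_error[OF assms(4) x assms(3)] unfolding distrib_left by linarith
qed

text \<open>
  The residual of the exact solution in the step that freezes the rate at the old time and takes \<open>c\<close> at
  the new one. The function \<open>s \<mapsto> c x s + s * q\<close>, where \<open>- q\<close> is that mixed right-hand side, has a
  derivative of size \<open>h\<close> on the step, since \<open>c\<close> and the rate are both Lipschitz in time; the mean value
  inequality supplies the second factor \<open>h\<close>.
\<close>

lemma truncation_error:
  assumes x: "x \<in> {0..L}" and t: "t \<in> {0..T}" "t + h \<in> {0..T}" and h: "h \<ge> 0"
  shows "\<bar>c x (t + h) - c x t + h * (c x (t + h) * f x * rate x t)\<bar>
    \<le> F * (a1 * (l1 - l0) * Ct + M * Rt) * h\<^sup>2"
proof -
  let ?A = "a1 * (l1 - l0)"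
  let ?q = "c x (t + h) * f x * rate x t"
  have A: "?A \<ge> 0" using a1_pos l0_less_l1 by simp
  have "norm ((c x (t + h) + (t + h) * ?q) - (c x t + t * ?q)) \<le> (F * (?A * Ct + M * Rt) * h) * norm ((t + h) - t)"
  proof (rule field_differentiable_bound[where S="{t..t+h}"])
    fix s assume s: "s \<in> {t..t + h}"
    hence sT: "s \<in> {0..T}" using t by auto
    have "((\<lambda>s. c x s + s * ?q) has_real_derivative - c x s * f x * rate x s + 1 * ?q) (at s within {0..T})"
      by (intro DERIV_add c_deriv x sT DERIV_cmult_right DERIV_ident)
    thus "((\<lambda>s. c x s + s * ?q) has_real_derivative f x * (c x (t + h) * rate x t - c x s * rate x s))
        (at s within {t..t + h})"
      using t by (auto intro: DERIV_subset simp: algebra_simps)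
    have "\<bar>c x (t + h) * rate x t - c x s * rate x s\<bar> \<le> ?A * (Ct * h) + M * (Rt * h)"
    proof (rule abs_mult_diff_le)
      have "\<bar>c x (t + h) - c x s\<bar> \<le> Ct * \<bar>t + h - s\<bar>" by (rule c_lip_t[OF x t(2) sT])
      also have "\<dots> \<le> Ct * h" using s Ct_nonneg by (intro mult_left_mono) auto
      finally show "\<bar>c x (t + h) - c x s\<bar> \<le> Ct * h" .
      have "\<bar>rate x t - rate x s\<bar> \<le> Rt * \<bar>t - s\<bar>" by (rule rate_lip_t[OF x t(1) sT])
      also have "\<dots> \<le> Rt * h" using s Rt_nonneg by (intro mult_left_mono) auto
      finally show "\<bar>rate x t - rate x s\<bar> \<le> Rt * h" .
      show "\<bar>rate x t\<bar> \<le> ?A" using rate_range[OF x t(1)] by simp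
      show "\<bar>c x s\<bar> \<le> M" by (rule c_le[OF x sT])
    qed
    hence "\<bar>f x\<bar> * \<bar>c x (t + h) * rate x t - c x s * rate x s\<bar> \<le> F * (?A * (Ct * h) + M * (Rt * h))"
      using f_le[OF x] f_nonneg[OF x] F_nonneg by (intro mult_mono) auto
    also have "F * (?A * (Ct * h) + M * (Rt * h)) = F * (?A * Ct + M * Rt) * h"
      by (simp add: algebra_simps)
    finally show "norm (f x * (c x (t + h) * rate x t - c x s * rate x s)) \<le> F * (?A * Ct + M * Rt) * h"
      by (simp only: real_norm_def abs_mult)
  qed (use h in auto)
  thus ?thesis using h by (simp add: algebra_simps power2_eq_square)
qed

text \<open>
  One step multiplies the error by at most \<open>1 + growth C * \<Delta>t\<close>. The first summand is the truncation
  constant; in the second, \<open>C\<close> measures \<open>\<phi> h - h\<close> against \<open>h\<^sup>2\<close>, and \<open>1\<close>, \<open>L * Cx\<close> and \<open>L\<close> come from the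
  wavelength quadrature, the space quadrature and the error already present.
\<close>

definition growth :: "real \<Rightarrow> real" where
  "growth C = F * (a1 * (l1 - l0) * Ct + M * Rt)
     + M * F * (C * (a1 * (l1 - l0)) + K * (l1 - l0) * (1 + L * Cx + L))"

lemma growth_nonneg: "C \<ge> 0 \<Longrightarrow> growth C \<ge> 0"
  unfolding growth_def
  using F_nonneg a1_pos l0_less_l1 Ct_nonneg M_pos Rt_nonneg K_nonneg L_pos Cx_nonneg by simp

lemma scheme_step:
  assumes "nsfd_scheme L T l0 l1 \<mu> a1 a2 f c0 I \<epsilon>A \<epsilon>B \<phi> Nx Nt Nl u" and "Nx > 0"
    and "n < Nt" and "j \<le> Nx" and "\<phi> (T / real Nt) > 0"
  shows "u (Suc n) j - u n j = - \<phi> (T / real Nt) * (u (Suc n) j * f (real j * (L / real Nx))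
    * discrete_rate Nl (real j * (L / real Nx)) (L / real Nx * (\<Sum>r<j. u n r)))"
proof -
  let ?x = "real j * (L / real Nx)" and ?k = "\<phi> (T / real Nt)"
  have x: "?x \<in> {0..L}" using grid_in_interval[OF assms(2,4)] L_pos by simp
  have "(u (Suc n) j - u n j) / ?k = - u (Suc n) j * f ?x * ((l1 - l0) / real Nl) *
      (\<Sum>m<Nl. spectral (l0 + real m * ((l1 - l0) / real Nl)) (S ?x 0) (L / real Nx * (\<Sum>r<j. u n r)))"
    using assms(1,3,4) unfolding nsfd_scheme_def Let_def spectral_def cumulative_eq_S[OF x, symmetric] by blast
  hence "(u (Suc n) j - u n j) / ?k
      = - (u (Suc n) j * f ?x * discrete_rate Nl ?x (L / real Nx * (\<Sum>r<j. u n r)))"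
    unfolding discrete_rate_def by simp
  thus ?thesis using assms(5) by (simp add: divide_eq_eq mult_ac)
qed

text \<open>
  Stability without any restriction on the steps: no step increases the modulus, and the initial values
  are values of \<open>c\<close>.
\<close>

lemma scheme_bounded:
  assumes scheme: "nsfd_scheme L T l0 l1 \<mu> a1 a2 f c0 I \<epsilon>A \<epsilon>B \<phi> Nx Nt Nl u"
    and N: "Nx > 0" "Nl > 0" and \<phi>: "\<phi> (T / real Nt) > 0" and j: "j \<le> Nx"
  shows "n \<le> Nt \<Longrightarrow> \<bar>u n j\<bar> \<le> M"
proof (induction n)
  case 0
  have x: "real j * (L / real Nx) \<in> {0..L}" using grid_in_interval[OF N(1) j] L_pos by simp
  have "u 0 j = c (real j * (L / real Nx)) 0"
    using scheme j initial[OF x] unfolding nsfd_scheme_def Let_def by simp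
  thus ?case using c_le[OF x, of 0] T_pos by simp
next
  case (Suc n)
  have x: "real j * (L / real Nx) \<in> {0..L}" using grid_in_interval[OF N(1) j] L_pos by simp
  have "\<bar>u (Suc n) j\<bar> \<le> \<bar>u n j\<bar>"
    by (rule implicit_step_contracts[OF scheme_step[OF scheme N(1) _ j \<phi>]])
       (use Suc \<phi> f_nonneg[OF x] discrete_rate_range(1)[OF N(2)] in auto)
  thus ?case using Suc by simp
qed

text \<open>
  Consistency and stability combined: every perturbation in \<open>implicit_step_error\<close> carries a factor \<open>\<Delta>t\<close>,
  so that one step yields a linear recursion for the uniform error bound \<open>E\<close>.
\<close>

lemma error_step:
  assumes scheme: "nsfd_scheme L T l0 l1 \<mu> a1 a2 f c0 I \<epsilon>A \<epsilon>B \<phi> Nx Nt Nl u"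
    and N: "Nx > 0" "Nt > 0" "Nl > 0" and \<phi>: "\<phi> (T / real Nt) > 0"
    and C: "C \<ge> 0" "\<bar>\<phi> (T / real Nt) - T / real Nt\<bar> \<le> C * (T / real Nt)\<^sup>2"
    and n: "n < Nt" and E: "E \<ge> 0"
      "\<And>r. r \<le> Nx \<Longrightarrow> \<bar>c (real r * (L / real Nx)) (real n * (T / real Nt)) - u n r\<bar> \<le> E"
    and j: "j \<le> Nx"
  shows "\<bar>c (real j * (L / real Nx)) (real (Suc n) * (T / real Nt)) - u (Suc n) j\<bar>
    \<le> (1 + growth C * (T / real Nt)) * E
      + growth C * (T / real Nt) * (T / real Nt + L / real Nx + (l1 - l0) / real Nl)"
proof -
  define dx where "dx = L / real Nx"
  define dt where "dt = T / real Nt"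
  define dl where "dl = (l1 - l0) / real Nl"
  define x where "x = real j * dx"
  define t where "t = real n * dt"
  define A where "A = a1 * (l1 - l0)"
  define KD where "KD = K * (l1 - l0)"
  define Q where "Q = discrete_rate Nl x (dx * (\<Sum>r<j. u n r))"
  have pos: "dx > 0" "dt > 0" "dl > 0"
    using L_pos T_pos l0_less_l1 N by (simp_all add: dx_def dt_def dl_def)
  have nn: "A \<ge> 0" "KD \<ge> 0" using a1_pos l0_less_l1 K_nonneg by (simp_all add: A_def KD_def)
  have x: "x \<in> {0..L}" using grid_in_interval[OF N(1) j, of L] L_pos by (simp add: x_def dx_def)
  have t': "real (Suc n) * dt = t + dt" by (simp add: t_def algebra_simps)
  have t: "t \<in> {0..T}" "t + dt \<in> {0..T}"
    using grid_in_interval[OF N(2), of n T] grid_in_interval[OF N(2), of "Suc n" T] n T_pos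
    unfolding t'[symmetric] by (auto simp: t_def dt_def)
  define \<tau> where "\<tau> = c x (t + dt) - c x t + dt * (c x (t + dt) * f x * rate x t)"
  have \<tau>: "\<bar>\<tau>\<bar> \<le> F * (A * Ct + M * Rt) * dt\<^sup>2"
    unfolding \<tau>_def A_def using pos by (intro truncation_error x t) auto
  have Q: "0 \<le> Q" "Q \<le> A" unfolding Q_def A_def using discrete_rate_range[OF N(3)] by auto
  have "\<bar>Q - rate x t\<bar> \<le> KD * (dl + L * (Cx * dx + E))"
    unfolding Q_def x_def KD_def dl_def
  proof (rule discrete_rate_error[OF pos(1) _ t(1) N(3) E(1)])
    show "real j * dx \<le> L" using x by (simp add: x_def)
    show "\<bar>u n r\<bar> \<le> M" if "r < j" for r
      using scheme_bounded[where n=n, OF scheme N(1,3) \<phi>, of r] that j n by simp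
    show "\<bar>c (real r * dx) t - u n r\<bar> \<le> E" if "r < j" for r
      using E(2)[of r] that j by (simp add: dx_def t_def dt_def)
  qed
  moreover have "(\<bar>\<phi> dt - dt\<bar>) * Q \<le> (C * dt\<^sup>2) * A"
    using C Q nn by (intro mult_mono) (auto simp: dt_def)
  ultimately have "\<bar>\<phi> dt - dt\<bar> * Q + dt * \<bar>Q - rate x t\<bar> \<le> (C * dt\<^sup>2) * A + dt * (KD * (dl + L * (Cx * dx + E)))"
    using pos by (intro add_mono mult_left_mono) auto
  hence rates: "\<bar>c x (t + dt)\<bar> * f x * (\<bar>\<phi> dt - dt\<bar> * Q + dt * \<bar>Q - rate x t\<bar>)
      \<le> M * F * ((C * dt\<^sup>2) * A + dt * (KD * (dl + L * (Cx * dx + E))))"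
    using c_le[OF x t(2)] f_nonneg[OF x] f_le[OF x] F_nonneg M_pos Q pos
    by (intro mult_mono) auto
  have "\<bar>c x (t + dt) - u (Suc n) j\<bar> \<le> \<bar>c x t - u n j\<bar> + \<bar>\<tau>\<bar>
      + \<bar>c x (t + dt)\<bar> * f x * (\<bar>\<phi> dt - dt\<bar> * Q + dt * \<bar>Q - rate x t\<bar>)"
  proof (rule implicit_step_error)
    show "c x (t + dt) - c x t = - dt * (c x (t + dt) * f x * rate x t) + \<tau>" by (simp add: \<tau>_def)
    show "u (Suc n) j - u n j = - \<phi> dt * (u (Suc n) j * f x * Q)"
      unfolding dt_def Q_def x_def dx_def by (rule scheme_step[OF scheme N(1) n j \<phi>])
  qed (use \<phi> f_nonneg[OF x] Q pos in \<open>auto simp: dt_def\<close>)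
  also have "\<dots> \<le> E + F * (A * Ct + M * Rt) * dt\<^sup>2
      + M * F * ((C * dt\<^sup>2) * A + dt * (KD * (dl + L * (Cx * dx + E))))"
    using E(2)[OF j] \<tau> rates by (intro add_mono) (auto simp: x_def dx_def t_def dt_def)
  also have "\<dots> = E + dt * (F * (A * Ct + M * Rt) * dt + M * F * (C * A) * dt
      + M * F * KD * dl + M * F * KD * (L * Cx) * dx + M * F * KD * L * E)"
    by (simp add: power2_eq_square algebra_simps)
  also have "\<dots> \<le> E + dt * (growth C * (dt + dx + dl + E))"
  proof -
    \<comment> \<open>All summands of \<open>growth C\<close> are nonnegative, so it dominates each coefficient separately.\<close>
    define p q where "p = F * (A * Ct + M * Rt)" and "q = M * F * (C * A)"
    define r where "r = M * F * KD"
    have g: "growth C = p + q + r + r * (L * Cx) + r * L"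
      unfolding growth_def p_def q_def r_def A_def KD_def by (simp add: algebra_simps)
    have nonneg: "p \<ge> 0" "q \<ge> 0" "r \<ge> 0" "r * (L * Cx) \<ge> 0" "r * L \<ge> 0"
      unfolding p_def q_def r_def
      using F_nonneg nn Ct_nonneg M_pos Rt_nonneg C L_pos Cx_nonneg by simp_all
    have "p * dt + q * dt \<le> growth C * dt" "r * dl \<le> growth C * dl"
      "r * (L * Cx) * dx \<le> growth C * dx" "r * L * E \<le> growth C * E"
      unfolding distrib_right[symmetric] using nonneg pos E by (intro mult_right_mono; simp add: g)+
    hence "p * dt + q * dt + r * dl + r * (L * Cx) * dx + r * L * E \<le> growth C * (dt + dx + dl + E)"
      unfolding distrib_left by linarith
    thus ?thesis unfolding p_def q_def r_def using pos by (intro add_left_mono mult_left_mono) auto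
  qed
  also have "\<dots> = (1 + growth C * dt) * E + growth C * dt * (dt + dx + dl)"
    by (simp add: algebra_simps)
  finally show ?thesis
    unfolding t'[symmetric] unfolding x_def dx_def dt_def dl_def .
qed

text \<open>
  The recursion \<open>E' = (1 + k) * E + k * h\<close> with \<open>E = 0\<close> at the start has the solution
  \<open>((1 + k) ^ n - 1) * h\<close>. With \<open>k = growth C * \<Delta>t\<close> and \<open>n * \<Delta>t \<le> T\<close>, the bracket stays below
  \<open>exp (growth C * T)\<close>.
\<close>

lemma error_bound:
  assumes scheme: "nsfd_scheme L T l0 l1 \<mu> a1 a2 f c0 I \<epsilon>A \<epsilon>B \<phi> Nx Nt Nl u"
    and N: "Nx > 0" "Nt > 0" "Nl > 0" and \<phi>: "\<phi> (T / real Nt) > 0"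
    and C: "C \<ge> 0" "\<bar>\<phi> (T / real Nt) - T / real Nt\<bar> \<le> C * (T / real Nt)\<^sup>2"
  shows "max_error L T Nx Nt c u \<le> exp (growth C * T) * (T / real Nt + L / real Nx + (l1 - l0) / real Nl)"
proof -
  define dt where "dt = T / real Nt"
  define h where "h = dt + L / real Nx + (l1 - l0) / real Nl"
  define k where "k = growth C * dt"
  have h: "h \<ge> 0" using L_pos T_pos l0_less_l1 N by (simp add: h_def dt_def)
  have k: "k \<ge> 0" using growth_nonneg[OF C(1)] T_pos N by (simp add: k_def dt_def)
  have step: "\<forall>j\<le>Nx. \<bar>c (real j * (L / real Nx)) (real n * dt) - u n j\<bar> \<le> ((1 + k) ^ n - 1) * h"
    if "n \<le> Nt" for n
    using that
  proof (induction n)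
    case 0
    show ?case
    proof (intro allI impI)
      fix j assume j: "j \<le> Nx"
      have "real j * (L / real Nx) \<in> {0..L}" using grid_in_interval[OF N(1) j] L_pos by simp
      thus "\<bar>c (real j * (L / real Nx)) (real 0 * dt) - u 0 j\<bar> \<le> ((1 + k) ^ 0 - 1) * h"
        using scheme j initial unfolding nsfd_scheme_def Let_def by simp
    qed
  next
    case (Suc n)
    show ?case
    proof (intro allI impI)
      fix j assume j: "j \<le> Nx"
      have "((1 + k) ^ n - 1) * h \<ge> 0" using k h by simp
      hence "\<bar>c (real j * (L / real Nx)) (real (Suc n) * dt) - u (Suc n) j\<bar>
          \<le> (1 + k) * (((1 + k) ^ n - 1) * h) + k * h"
        unfolding k_def dt_def h_def using Suc
        by (intro error_step[OF scheme N \<phi> C]) (auto simp: k_def dt_def h_def j)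
      also have "\<dots> = ((1 + k) ^ Suc n - 1) * h" by (simp add: algebra_simps)
      finally show "\<bar>c (real j * (L / real Nx)) (real (Suc n) * dt) - u (Suc n) j\<bar>
          \<le> ((1 + k) ^ Suc n - 1) * h" .
    qed
  qed
  have grow: "((1 + k) ^ n - 1) * h \<le> exp (growth C * T) * h" if "n \<le> Nt" for n
  proof (rule mult_right_mono[OF _ h])
    have "(1 + k) ^ n \<le> (1 + k) ^ Nt" using k that by (intro power_increasing) auto
    also have "\<dots> \<le> exp k ^ Nt" using k exp_ge_add_one_self[of k] by (intro power_mono) auto
    also have "\<dots> = exp (real Nt * k)" by (rule exp_of_nat_mult[symmetric])
    also have "real Nt * k = growth C * T" using N by (simp add: k_def dt_def)
    finally show "(1 + k) ^ n - 1 \<le> exp (growth C * T)" by simp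
  qed
  show ?thesis
    unfolding max_error_def dt_def[symmetric] h_def[symmetric]
  proof (rule Max.boundedI)
    fix y assume "y \<in> (\<lambda>(n, j). \<bar>c (real j * (L / real Nx)) (real n * dt) - u n j\<bar>) ` ({..Nt} \<times> {..Nx})"
    then obtain n j where "n \<le> Nt" "j \<le> Nx"
      "y = \<bar>c (real j * (L / real Nx)) (real n * dt) - u n j\<bar>" by auto
    thus "y \<le> exp (growth C * T) * h" using step grow by (meson order_trans)
  qed auto
qed

end

section \<open>Convergence of order one\<close>

theorem theorem3p3:
  fixes L T l0 l1 \<mu> a1 a2 :: real
    and f c0 I \<epsilon>A \<epsilon>B \<phi> :: "real \<Rightarrow> real"
    and c :: "real \<Rightarrow> real \<Rightarrow> real"
  assumes "L > 0" and "T > 0" and "l0 < l1" and "\<mu> > 0" and "a1 > 0" and "a2 \<ge> 0"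
    and "C1_on_interval 0 L f" and "C1_on_interval 0 L c0"
    and "C1_on_interval l0 l1 I" and "C1_on_interval l0 l1 \<epsilon>A" and "C1_on_interval l0 l1 \<epsilon>B"
    and "\<forall>x\<in>{0..L}. f x \<ge> 0"
    and "\<forall>l\<in>{l0..l1}. 0 \<le> I l \<and> I l \<le> 1"
    and "\<forall>x\<in>{0..L}. c0 x > 0"
    and "\<forall>h>0. \<phi> h > 0"
    and "(\<lambda>h. \<phi> h - h) \<in> O[at_right 0](\<lambda>h. h\<^sup>2)"
    and "classical_solution L T l0 l1 \<mu> a1 a2 f c0 I \<epsilon>A \<epsilon>B c"
  shows "(\<forall>e>0. \<exists>d>0. \<forall>Nx>0. \<forall>Nt>0. \<forall>Nl>0. \<forall>u.
            L / real Nx + T / real Nt + (l1 - l0) / real Nl < d \<longrightarrow>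
            nsfd_scheme L T l0 l1 \<mu> a1 a2 f c0 I \<epsilon>A \<epsilon>B \<phi> Nx Nt Nl u \<longrightarrow>
            max_error L T Nx Nt c u < e)
       \<and> (\<exists>\<kappa>>0. \<exists>d>0. \<forall>Nx>0. \<forall>Nt>0. \<forall>Nl>0. \<forall>u.
            L / real Nx + T / real Nt + (l1 - l0) / real Nl < d \<longrightarrow>
            nsfd_scheme L T l0 l1 \<mu> a1 a2 f c0 I \<epsilon>A \<epsilon>B \<phi> Nx Nt Nl u \<longrightarrow>
            max_error L T Nx Nt c u \<le> \<kappa> * (T / real Nt + L / real Nx + (l1 - l0) / real Nl))"
proof -
  interpret photochemical_model L T l0 l1 \<mu> a1 a2 f c0 I \<epsilon>A \<epsilon>B c
    using assms by unfold_locales auto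
  obtain M F K Ct Cx Rt where
    reg: "regular_solution L T l0 l1 \<mu> a1 a2 f c0 I \<epsilon>A \<epsilon>B c M F K Ct Cx Rt"
    using solution_regularity by blast
  then interpret regular_solution L T l0 l1 \<mu> a1 a2 f c0 I \<epsilon>A \<epsilon>B c M F K Ct Cx Rt .
  obtain C where C: "C > 0" "eventually (\<lambda>h. norm (\<phi> h - h) \<le> C * norm (h\<^sup>2)) (at_right 0)"
    using assms(16) by (elim landau_o.bigE)
  then obtain d where d: "d > 0" "\<And>h. \<lbrakk>0 < h; h < d\<rbrakk> \<Longrightarrow> \<bar>\<phi> h - h\<bar> \<le> C * h\<^sup>2"
    unfolding eventually_at_right[OF zero_less_one] by auto
  define \<kappa> where "\<kappa> = exp (growth C * T)"
  have \<kappa>: "\<kappa> > 0" by (simp add: \<kappa>_def)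
  have bound: "max_error L T Nx Nt c u \<le> \<kappa> * (T / real Nt + L / real Nx + (l1 - l0) / real Nl)"
    if N: "Nx > 0" "Nt > 0" "Nl > 0" and small: "L / real Nx + T / real Nt + (l1 - l0) / real Nl < d"
      and scheme: "nsfd_scheme L T l0 l1 \<mu> a1 a2 f c0 I \<epsilon>A \<epsilon>B \<phi> Nx Nt Nl u" for Nx Nt Nl u
  proof -
    have pos: "L / real Nx > 0" "T / real Nt > 0" "(l1 - l0) / real Nl > 0"
      using L_pos T_pos l0_less_l1 N by simp_all
    hence "\<bar>\<phi> (T / real Nt) - T / real Nt\<bar> \<le> C * (T / real Nt)\<^sup>2"
      using small by (intro d(2)) auto
    thus ?thesis unfolding \<kappa>_def
      using error_bound[OF scheme N, of C] C(1) assms(15) pos by auto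
  qed
  show ?thesis
  proof (intro conjI allI impI)
    fix e :: real assume e: "e > 0"
    show "\<exists>d>0. \<forall>Nx>0. \<forall>Nt>0. \<forall>Nl>0. \<forall>u.
            L / real Nx + T / real Nt + (l1 - l0) / real Nl < d \<longrightarrow>
            nsfd_scheme L T l0 l1 \<mu> a1 a2 f c0 I \<epsilon>A \<epsilon>B \<phi> Nx Nt Nl u \<longrightarrow>
            max_error L T Nx Nt c u < e"
    \<comment> \<open>The error is at most \<open>\<kappa>\<close> times the sum of the steps, so a sum below \<open>e / \<kappa>\<close> suffices.\<close>
    proof (intro exI[of _ "min d (e / \<kappa>)"] conjI allI impI)
      fix Nx Nt Nl :: nat and u
      assume N: "Nx > 0" "Nt > 0" "Nl > 0"
        and small: "L / real Nx + T / real Nt + (l1 - l0) / real Nl < min d (e / \<kappa>)"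
        and scheme: "nsfd_scheme L T l0 l1 \<mu> a1 a2 f c0 I \<epsilon>A \<epsilon>B \<phi> Nx Nt Nl u"
      have "\<kappa> * (T / real Nt + L / real Nx + (l1 - l0) / real Nl) < e"
        using small \<kappa> by (simp add: less_divide_eq mult.commute add_ac)
      with bound[OF N _ scheme] small show "max_error L T Nx Nt c u < e" by simp
    qed (use d e \<kappa> in auto)
  next
    show "\<exists>\<kappa>>0. \<exists>d>0. \<forall>Nx>0. \<forall>Nt>0. \<forall>Nl>0. \<forall>u.
            L / real Nx + T / real Nt + (l1 - l0) / real Nl < d \<longrightarrow>
            nsfd_scheme L T l0 l1 \<mu> a1 a2 f c0 I \<epsilon>A \<epsilon>B \<phi> Nx Nt Nl u \<longrightarrow>
            max_error L T Nx Nt c u \<le> \<kappa> * (T / real Nt + L / real Nx + (l1 - l0) / real Nl)"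
      using \<kappa> d(1) bound by blast
  qed
qed

end
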